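(* Let $G$ be a cyclic group of odd order $|G|\ge3$. If $G'$ is any finite abelian group of odd order with $\mathcal L(\mathcal B_\pm(G'))=\mathcal L(\mathcal B_\pm(G))$, then $G$ and $G'$ are isomorphic.
   Context: For a finite abelian group $G$ (written additively), $\mathcal F(G)$ is the (multiplicative) free abelian monoid with basis $G$, and $\mathcal B_\pm(G)=\{g_1\cdot\ldots\cdot g_\ell\in\mathcal F(G):\ \ell\ge0,\ \varepsilon_1g_1+\dots+\varepsilon_\ell g_\ell=0\text{ for some }\varepsilon_i\in\{1,-1\}\}$, a reduced atomic monoid. For an element $a$ of a reduced atomic monoid $H$, the set of lengths $\mathsf L(a)$ is the set of all $k\in\mathbb N_0$ such that $a$ is a product of $k$ atoms (irreducible elements) of $H$, and $\mathcal L(H)=\{\mathsf L(a):a\in H\}$ is the system of sets of lengths. *)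

theory Defs
  imports "HOL-Algebra.FiniteProduct" "HOL-Algebra.Divisibility" "HOL-Algebra.Elementary_Groups"
begin

text \<open>
  HOL-Algebra groups are multiplicative: \<open>\<epsilon>\<^sub>1 g\<^sub>1 + \<dots> + \<epsilon>\<^sub>l g\<^sub>l = 0\<close> becomes
  \<open>g\<^sub>1 [^] \<epsilon>\<^sub>1 \<otimes> \<dots> \<otimes> g\<^sub>l [^] \<epsilon>\<^sub>l = \<one>\<close>. An element of the free abelian monoid over \<open>G\<close> is a
  multiset over \<^term>\<open>carrier G\<close>. The sign belongs to a position of the enumeration \<open>gs\<close>, so
  equal terms may receive different signs.
\<close>

definition pm_zero_sum :: "('a, 'b) monoid_scheme \<Rightarrow> 'a multiset \<Rightarrow> bool" where
  "pm_zero_sum G S \<longleftrightarrow>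
     (\<exists>gs. \<exists>\<epsilon> :: nat \<Rightarrow> int.
        mset gs = S \<and> (\<forall>i<length gs. \<epsilon> i \<in> {1, -1}) \<and>
        finprod G (\<lambda>i. gs ! i [^]\<^bsub>G\<^esub> \<epsilon> i) {..<length gs} = \<one>\<^bsub>G\<^esub>)"

definition pm_monoid :: "('a, 'b) monoid_scheme \<Rightarrow> 'a multiset monoid" where
  "pm_monoid G =
     \<lparr>carrier = {S. set_mset S \<subseteq> carrier G \<and> pm_zero_sum G S}, monoid.mult = (+), one = {#}\<rparr>"

text \<open>
  \<^const>\<open>factors\<close> does not confine the factors to the carrier, hence the explicit condition.
  It asks for equality of the product with \<open>a\<close>, not just for associatedness; the notion is used
  for reduced monoids. The empty product is allowed, so \<open>0\<close> is a length of \<open>\<one>\<close>.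
\<close>

definition set_of_lengths :: "('a, 'b) monoid_scheme \<Rightarrow> 'a \<Rightarrow> nat set" where
  "set_of_lengths H a = {k. \<exists>fs. set fs \<subseteq> carrier H \<and> factors H fs a \<and> length fs = k}"

definition system_of_lengths :: "('a, 'b) monoid_scheme \<Rightarrow> nat set set" where
  "system_of_lengths H = set_of_lengths H ` carrier H"

lemma pm_zero_sum_add:
  assumes "comm_group G" "set_mset S \<subseteq> carrier G" "set_mset T \<subseteq> carrier G"
    and "pm_zero_sum G S" "pm_zero_sum G T"
  shows "pm_zero_sum G (S + T)"
proof -
  interpret comm_group G by fact
  obtain gs e where S: "mset gs = S" "\<forall>i<length gs. e i \<in> {1, -1::int}"
    "finprod G (\<lambda>i. gs ! i [^]\<^bsub>G\<^esub> e i) {..<length gs} = \<one>\<^bsub>G\<^esub>"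
    using assms(4) unfolding pm_zero_sum_def by blast
  obtain hs d where T: "mset hs = T" "\<forall>i<length hs. d i \<in> {1, -1::int}"
    "finprod G (\<lambda>i. hs ! i [^]\<^bsub>G\<^esub> d i) {..<length hs} = \<one>\<^bsub>G\<^esub>"
    using assms(5) unfolding pm_zero_sum_def by blast
  have gc: "gs ! i \<in> carrier G" if "i < length gs" for i
    using that S(1) assms(2) by (metis nth_mem set_mset_mset subsetD)
  have hc: "hs ! i \<in> carrier G" if "i < length hs" for i
    using that T(1) assms(3) by (metis nth_mem set_mset_mset subsetD)
  define n where "n = length gs"
  define m where "m = length hs"
  define c where "c = (\<lambda>i. if i < n then e i else d (i - n))"
  let ?f = "\<lambda>i. (gs @ hs) ! i [^]\<^bsub>G\<^esub> c i"
  have split: "{..<n + m} = {..<n} \<union> (\<lambda>i. n + i) ` {..<m}"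
    by (auto simp: lessThan_atLeast0 image_add_atLeastLessThan)
  have f1: "?f \<in> {..<n} \<rightarrow> carrier G"
    using gc by (auto simp: n_def nth_append)
  have f2: "?f \<in> (\<lambda>i. n + i) ` {..<m} \<rightarrow> carrier G"
    using hc by (auto simp: n_def m_def nth_append)
  have "finprod G ?f {..<n + m}
      = finprod G ?f {..<n} \<otimes>\<^bsub>G\<^esub> finprod G ?f ((\<lambda>i. n + i) ` {..<m})"
    unfolding split using f1 f2 by (intro finprod_Un_disjoint) auto
  also have "finprod G ?f {..<n} = finprod G (\<lambda>i. gs ! i [^]\<^bsub>G\<^esub> e i) {..<n}"
    using gc by (intro finprod_cong') (auto simp: n_def c_def nth_append)
  also have "\<dots> = \<one>\<^bsub>G\<^esub>"
    using S(3) by (simp add: n_def)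
  also have "finprod G ?f ((\<lambda>i. n + i) ` {..<m}) = finprod G (\<lambda>i. ?f (n + i)) {..<m}"
    using f2 by (intro finprod_reindex) auto
  also have "\<dots> = finprod G (\<lambda>i. hs ! i [^]\<^bsub>G\<^esub> d i) {..<m}"
    using hc by (intro finprod_cong') (auto simp: n_def m_def c_def nth_append)
  also have "\<dots> = \<one>\<^bsub>G\<^esub>"
    using T(3) by (simp add: m_def)
  finally have "finprod G ?f {..<n + m} = \<one>\<^bsub>G\<^esub>" by simp
  moreover have "\<forall>i<length (gs @ hs). c i \<in> {1, -1}"
    using S(2) T(2) by (auto simp: c_def n_def)
  ultimately show ?thesis
    unfolding pm_zero_sum_def using S(1) T(1)
    by (intro exI[of _ "gs @ hs"] exI[of _ c]) (simp add: n_def m_def)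
qed

lemma comm_monoid_cancel_pm_monoid:
  assumes "comm_group G"
  shows "comm_monoid_cancel (pm_monoid G)"
proof -
  interpret comm_group G by fact
  have "pm_zero_sum G {#}"
    unfolding pm_zero_sum_def by (intro exI[of _ "[]"]) simp
  then have "comm_monoid (pm_monoid G)"
    by (intro comm_monoidI) (auto simp: pm_monoid_def pm_zero_sum_add[OF assms])
  then show ?thesis
    by (rule comm_monoid_cancelI) (simp add: pm_monoid_def)
qed

lemma Units_pm_monoid: "Units (pm_monoid G) \<subseteq> {{#}}"
  by (auto simp: Units_def pm_monoid_def)

end

theory Submission
  imports Defs "HOL-Algebra.Multiplicative_Group"
begin

text \<open>
  The group operation is written multiplicatively, and \<open>n\<close> is the order of the cyclic group \<open>G\<close>. Call a
  multiset over a group a zero-sum multiset if some choice of exponents \<open>\<plusminus>1\<close> makes its product trivial.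
  For odd order, \<open>{#x, x#}\<close> is an atom for every \<open>x \<noteq> \<one>\<close>, and hence \<open>2\<close> and the size of \<open>U\<close> are lengths
  of \<open>U + U\<close> for every atom \<open>U\<close> of size at least \<open>2\<close>; conversely a multiset that has \<open>2\<close> among its
  lengths has no length greater than \<open>2\<close> beyond the maximal size of an atom. Thus equality of the systems of lengths carries
  a bound on the size of atoms from \<open>G\<close> to \<open>G'\<close>, and over \<open>G\<close> the bound \<open>n\<close> holds by the
  pigeonhole principle for partial products. Over a generator \<open>g\<close> the
  atoms are \<open>g\<^sup>2\<close> and \<open>g\<^sup>n\<close> only, so \<open>g\<^bsup>2n\<^esup>\<close> has the set of lengths \<open>{2, n}\<close>. The theorem therefore follows
  once a group \<open>G'\<close> of odd order, all of whose atoms have size at most \<open>n\<close>, is shown to be cyclic of order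
  \<open>n\<close> as soon as some \<open>V\<close> has set of lengths \<open>{2, n}\<close>.

  Inverting elements of \<open>V\<close> changes nothing, so the factorization into \<open>n\<close> atoms, which all have size \<open>2\<close>,
  gives \<open>V = U + U\<close> with \<open>U\<close> of size \<open>n\<close>. Consider relations \<open>w\<close>, that is, integer exponents with
  \<open>\<Prod> x\<^bsup>w x\<^esup> = \<one>\<close>, bounded by the multiplicities of \<open>U\<close>. As the order is odd, a relation with even
  exponents can be halved. A nonzero bounded relation that is not divisible by \<open>2\<close> describes a zero-sum
  multiset \<open>W \<subseteq># U\<close> whose complement in \<open>U + U\<close> is zero-sum as well; since only the lengths \<open>2\<close>
  and \<open>n\<close> occur, \<open>W\<close> must be all of \<open>U\<close> (lemma \<open>bounded_relation_saturated\<close>). Applied to half-differences of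
  relations this shows that, up to sign, there is only one nonzero bounded relation, and after inverting some elements
  it is given by the multiplicities of \<open>U\<close> themselves. Such multisets are called tight.

  Now fix \<open>g\<close> in a tight \<open>U\<close> and put \<open>D = U - {#g#}\<close>. If \<open>x\<close> is not of the form \<open>\<Prod> z\<^bsup>t z\<^esup>\<close> with
  \<open>0 \<le> t z \<le> count D z\<close>, then replacing \<open>g\<close> in \<open>U\<close> by the two elements \<open>x\<close> and \<open>x g\<close> yields an atom of
  size \<open>n + 1\<close> (lemma \<open>exchange_in_tight_is_atom\<close>), a contradiction. Hence every group element has this form, and
  by tightness in exactly one way, so the order of \<open>G'\<close> is \<open>\<Prod> (count D z + 1)\<close> over the support of \<open>U\<close>.
  The order is odd. The factor for \<open>z = g\<close> shows that every multiplicity in \<open>U\<close> is odd, as \<open>g\<close> was arbitrary, and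
  any other factor would then be even. So \<open>U\<close> consists of \<open>n\<close> copies of \<open>g\<close>, and \<open>G'\<close> is generated by \<open>g\<close> and
  has order \<open>n\<close>.
\<close>

section \<open>Multisets and lists\<close>

lemma exists_multiset_with_counts:
  assumes "\<And>x. f x \<le> count U x"
  shows "\<exists>W. \<forall>x. count W x = f x"
proof -
  have "{x. 0 < f x} \<subseteq> set_mset U"
    using assms by (metis (mono_tags, lifting) count_greater_zero_iff mem_Collect_eq order_less_le_trans subsetI)
  then have "finite {x. 0 < f x}"
    by (rule finite_subset) simp
  then show ?thesis
    by (intro exI[of _ "Abs_multiset f"]) simp
qed

lemma size_sum_list: "size (sum_list fs :: 'a multiset) = sum_list (map size fs)"
  by (induction fs) auto

lemma member_sum_list_subset: "U \<in> set fs \<Longrightarrow> U \<subseteq># sum_list fs"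
  by (induction fs) (auto intro: subset_mset.add_increasing subset_mset.add_increasing2)

lemma sum_list_ge_twice_length:
  fixes ks :: "nat list"
  assumes "\<And>k. k \<in> set ks \<Longrightarrow> 2 \<le> k"
  shows "2 * length ks \<le> sum_list ks"
    and "sum_list ks \<le> 2 * length ks \<Longrightarrow> k \<in> set ks \<Longrightarrow> k = 2"
proof -
  have "2 * length ks \<le> sum_list ks \<and> (sum_list ks \<le> 2 * length ks \<longrightarrow> (\<forall>k\<in>set ks. k = 2))"
    using assms by (induction ks) force+
  then show "2 * length ks \<le> sum_list ks"
    and "sum_list ks \<le> 2 * length ks \<Longrightarrow> k \<in> set ks \<Longrightarrow> k = 2" by auto
qed

lemma sum_list_of_two_values:
  fixes m n :: nat
  assumes "set ks \<subseteq> {m, n}"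
  shows "\<exists>a b. length ks = a + b \<and> sum_list ks = m * a + n * b"
  using assms
proof (induction ks)
  case (Cons k ks)
  then obtain a b where ab: "length ks = a + b" "sum_list ks = m * a + n * b" by auto
  show ?case
  proof (cases "k = m")
    case True
    then show ?thesis using ab by (intro exI[of _ "Suc a"] exI[of _ b]) simp
  next
    case False
    then have "k = n" using Cons.prems by simp
    then show ?thesis using ab by (intro exI[of _ a] exI[of _ "Suc b"]) simp
  qed
qed simp

section \<open>Signed products in a finite abelian group\<close>

locale finite_abelian_group = comm_group G for G (structure) +
  assumes finite_carrier: "finite (carrier G)"
begin

text \<open>
  Exponent vectors are functions on the whole carrier, so that relations between group elements can be added, negated and halved pointwise.
\<close>

definition power_product :: "('a \<Rightarrow> int) \<Rightarrow> 'a" where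
  "power_product w = (\<Otimes>x\<in>carrier G. x [^] w x)"

lemma power_product_closed [simp, intro]: "power_product w \<in> carrier G"
  unfolding power_product_def by (intro finprod_closed) auto

lemma power_product_add: "power_product (\<lambda>x. v x + w x) = power_product v \<otimes> power_product w"
proof -
  have "power_product (\<lambda>x. v x + w x) = (\<Otimes>x\<in>carrier G. x [^] v x \<otimes> x [^] w x)"
    unfolding power_product_def by (intro finprod_cong') (auto simp: int_pow_mult)
  also have "\<dots> = power_product v \<otimes> power_product w"
    unfolding power_product_def by (intro finprod_multf) auto
  finally show ?thesis .
qed

lemma power_product_zero [simp]: "power_product (\<lambda>x. 0) = \<one>"
  unfolding power_product_def by (intro finprod_one_eqI) auto

lemma power_product_uminus: "power_product (\<lambda>x. - w x) = inv (power_product w)"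
proof -
  have "power_product (\<lambda>x. - w x) \<otimes> power_product w = \<one>"
    using power_product_add[of "\<lambda>x. - w x" w] by simp
  then show ?thesis
    by (simp add: inv_equality)
qed

lemma power_product_diff: "power_product (\<lambda>x. v x - w x) = power_product v \<otimes> inv (power_product w)"
  using power_product_add[of v "\<lambda>x. - w x"] by (simp add: power_product_uminus)

lemma power_product_single:
  assumes "x \<in> carrier G"
  shows "power_product (\<lambda>y. if y = x then k else 0) = x [^] k"
proof -
  have "power_product (\<lambda>y. if y = x then k else 0) = (\<Otimes>y\<in>carrier G. if y = x then y [^] k else \<one>)"
    unfolding power_product_def by (intro finprod_cong') auto
  also have "\<dots> = x [^] k"
    using assms finite_carrier by (intro finprod_singleton_swap) auto
  finally show ?thesis .
qed

definition mset_product :: "'a multiset \<Rightarrow> 'a" where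
  "mset_product S = power_product (\<lambda>x. int (count S x))"

lemma mset_product_closed [simp, intro]: "mset_product S \<in> carrier G"
  by (simp add: mset_product_def)

lemma mset_product_empty [simp]: "mset_product {#} = \<one>"
  by (simp add: mset_product_def)

lemma mset_product_plus: "mset_product (S + T) = mset_product S \<otimes> mset_product T"
  by (simp add: mset_product_def flip: power_product_add)

lemma mset_product_single [simp]: "x \<in> carrier G \<Longrightarrow> mset_product {#x#} = x"
  using power_product_single[of x 1] by (simp add: mset_product_def eq_commute[of x] if_distrib cong: if_cong)

lemma mset_product_add_mset: "x \<in> carrier G \<Longrightarrow> mset_product (add_mset x S) = x \<otimes> mset_product S"
  using mset_product_plus[of "{#x#}" S] by simp

lemma mset_product_inv:
  "set_mset S \<subseteq> carrier G \<Longrightarrow> mset_product (image_mset (\<lambda>x. inv x) S) = inv (mset_product S)"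
  by (induction S) (auto simp: mset_product_add_mset inv_mult)

text \<open>
  A choice of signs for the occurrences of \<open>x\<close> in \<open>S\<close> matters only through its sum \<open>w x\<close>. The sums that occur
  are the integers of absolute value at most \<open>count S x\<close> and of the same parity. This turns sign choices into
  integer vectors.
\<close>

definition signed_product :: "'a multiset \<Rightarrow> 'a \<Rightarrow> bool" where
  "signed_product S z \<longleftrightarrow>
     (\<exists>w. power_product w = z \<and> (\<forall>x. \<bar>w x\<bar> \<le> int (count S x) \<and> even (int (count S x) + w x)))"

lemma signed_productI:
  assumes "power_product w = z" "\<And>x. \<bar>w x\<bar> \<le> int (count S x)" "\<And>x. even (int (count S x) + w x)"
  shows "signed_product S z"
  using assms unfolding signed_product_def by blast

lemma signed_productE:
  assumes "signed_product S z"
  obtains w where "power_product w = z" "\<And>x. \<bar>w x\<bar> \<le> int (count S x)" "\<And>x. even (int (count S x) + w x)"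
  using assms unfolding signed_product_def by blast

lemma signed_product_closed: "signed_product S z \<Longrightarrow> z \<in> carrier G"
  by (auto elim: signed_productE)

lemma signed_product_empty [simp]: "signed_product {#} z \<longleftrightarrow> z = \<one>"
proof
  assume "signed_product {#} z"
  then obtain w where w: "power_product w = z" "\<And>x. \<bar>w x\<bar> \<le> int (count {#} x)"
    by (auto elim: signed_productE)
  then have "w = (\<lambda>x. 0)" by fastforce
  then show "z = \<one>" using w(1) by simp
qed (auto intro: signed_productI[of "\<lambda>x. 0"])

lemma signed_product_inv:
  assumes "signed_product S z" shows "signed_product S (inv z)"
proof -
  obtain w where w: "power_product w = z" "\<And>x. \<bar>w x\<bar> \<le> int (count S x)" "\<And>x. even (int (count S x) + w x)"
    using assms by (rule signed_productE) blast
  show ?thesis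
    by (rule signed_productI[of "\<lambda>x. - w x"]) (use w in \<open>auto simp: power_product_uminus\<close>)
qed

lemma signed_product_plus:
  assumes "signed_product S y" "signed_product T z"
  shows "signed_product (S + T) (y \<otimes> z)"
proof -
  obtain v where v: "power_product v = y" "\<And>x. \<bar>v x\<bar> \<le> int (count S x)" "\<And>x. even (int (count S x) + v x)"
    using assms(1) by (rule signed_productE) blast
  obtain w where w: "power_product w = z" "\<And>x. \<bar>w x\<bar> \<le> int (count T x)" "\<And>x. even (int (count T x) + w x)"
    using assms(2) by (rule signed_productE) blast
  show ?thesis
  proof (rule signed_productI[of "\<lambda>x. v x + w x"])
    fix x
    show "\<bar>v x + w x\<bar> \<le> int (count (S + T) x)"
      using v(2)[of x] w(2)[of x] by simp
    show "even (int (count (S + T) x) + (v x + w x))"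
      using v(3)[of x] w(3)[of x] by simp
  qed (use v w in \<open>simp add: power_product_add\<close>)
qed

lemma signed_product_single:
  "x \<in> carrier G \<Longrightarrow> signed_product {#x#} x"
  by (rule signed_productI[of "\<lambda>y. if y = x then 1 else 0"]) (auto simp: power_product_single)

lemma signed_product_mset_product: "signed_product S (mset_product S)"
  unfolding mset_product_def by (rule signed_productI) auto

text \<open>
  Together with the empty case, this recursion determines \<open>signed_product\<close>. Its right-hand side is symmetric in \<open>x\<close> and
  \<open>inv x\<close>, which is why signs of elements can be normalized freely.
\<close>

lemma signed_product_add_mset:
  assumes "x \<in> carrier G" "z \<in> carrier G"
  shows "signed_product (add_mset x S) z \<longleftrightarrow>
           signed_product S (z \<otimes> x) \<or> signed_product S (z \<otimes> inv x)" (is "?L \<longleftrightarrow> ?R")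
proof
  assume ?L
  then obtain w where w: "power_product w = z"
    and bound: "\<And>y. \<bar>w y\<bar> \<le> int (count (add_mset x S) y)"
    and parity: "\<And>y. even (int (count (add_mset x S) y) + w y)"
    by (rule signed_productE) blast
  show ?R
  proof (cases "w x < 0")
    case True
    have "signed_product S (z \<otimes> x)"
    proof (rule signed_productI[of "\<lambda>y. w y + (if y = x then 1 else 0)"])
      show "power_product (\<lambda>y. w y + (if y = x then 1 else 0)) = z \<otimes> x"
        using assms w by (simp add: power_product_add power_product_single)
      fix y
      show "\<bar>w y + (if y = x then 1 else 0)\<bar> \<le> int (count S y)"
        using bound[of y] True by (auto split: if_splits)
      show "even (int (count S y) + (w y + (if y = x then 1 else 0)))"
        using parity[of y] by (auto split: if_splits)
    qed
    then show ?thesis ..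
  next
    case False
    have "signed_product S (z \<otimes> inv x)"
    proof (rule signed_productI[of "\<lambda>y. w y - (if y = x then 1 else 0)"])
      show "power_product (\<lambda>y. w y - (if y = x then 1 else 0)) = z \<otimes> inv x"
        using assms w by (simp add: power_product_diff power_product_single)
      fix y
      \<comment> \<open>If \<open>w x = 0\<close>, then \<open>x\<close> occurs in \<open>add_mset x S\<close> an even number of times, hence in \<open>S\<close>.\<close>
      show "\<bar>w y - (if y = x then 1 else 0)\<bar> \<le> int (count S y)"
        using bound[of y] parity[of y] False by (cases "count S y"; cases "w y = 0") (auto split: if_splits)
      show "even (int (count S y) + (w y - (if y = x then 1 else 0)))"
        using parity[of y] by (auto split: if_splits)
    qed
    then show ?thesis ..
  qed
next
  assume ?R
  then show ?L
  proof
    assume "signed_product S (z \<otimes> x)"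
    from signed_product_plus[OF this signed_product_inv[OF signed_product_single[OF assms(1)]]]
    show ?L using assms by (simp add: m_assoc)
  next
    assume "signed_product S (z \<otimes> inv x)"
    from signed_product_plus[OF this signed_product_single[OF assms(1)]]
    show ?L using assms by (simp add: m_assoc)
  qed
qed

lemma signed_product_image_mset:
  assumes "\<And>x. x \<in> carrier G \<Longrightarrow> \<sigma> x \<in> {x, inv x}" "set_mset S \<subseteq> carrier G" "z \<in> carrier G"
  shows "signed_product (image_mset \<sigma> S) z \<longleftrightarrow> signed_product S z"
  using assms(2,3)
proof (induction S arbitrary: z)
  case (add x S)
  have x: "x \<in> carrier G" "\<sigma> x \<in> carrier G" using add.prems assms(1)[of x] by auto
  then show ?case
    using add assms(1)[of x] by (auto simp: signed_product_add_mset)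
qed simp

text \<open>
  Every subset of the positions of a signed sequence yields a signed product; with all positions this is one half of
  the comparison with \<open>pm_zero_sum\<close>, and with intervals of positions it drives the bound on the size of atoms.
\<close>

lemma signed_product_indices:
  assumes "finite I" "\<And>i. i \<in> I \<Longrightarrow> g i \<in> carrier G" "\<And>i. i \<in> I \<Longrightarrow> \<epsilon> i \<in> {1, -1 :: int}"
  shows "signed_product (image_mset g (mset_set I)) (\<Otimes>i\<in>I. g i [^] \<epsilon> i)"
  using assms
proof (induction I rule: finite_induct)
  case (insert i I)
  have g: "g i \<in> carrier G" and IH: "signed_product (image_mset g (mset_set I)) (\<Otimes>i\<in>I. g i [^] \<epsilon> i)"
    using insert by auto
  have "signed_product {#g i#} (g i [^] \<epsilon> i)"
    using insert.prems(2)[of i] signed_product_single[OF g]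
      signed_product_inv[OF signed_product_single[OF g]] g by (auto simp: int_pow_neg)
  from signed_product_plus[OF this IH] show ?case
    using insert by (subst finprod_insert) (auto simp: Pi_def)
qed simp

lemma image_nth_mset_set: "image_mset ((!) gs) (mset_set {..<length gs}) = mset gs"
  by (metis lessThan_atLeast0 map_nth mset_map mset_set_upto_eq_mset_upto atLeast0LessThan)

lemma signed_product_obtain_signs:
  assumes "set_mset S \<subseteq> carrier G" "signed_product S z"
  shows "\<exists>gs. \<exists>\<epsilon> :: nat \<Rightarrow> int. mset gs = S \<and> (\<forall>i<length gs. \<epsilon> i \<in> {1, -1}) \<and>
           (\<Otimes>i\<in>{..<length gs}. gs ! i [^] \<epsilon> i) = z"
  using assms
proof (induction S arbitrary: z)
  case (add x S)
  have x: "x \<in> carrier G" and z: "z \<in> carrier G"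
    using add.prems signed_product_closed by auto
  obtain e :: int where e: "e \<in> {1, -1}" "signed_product S (z \<otimes> inv (x [^] e))"
    using add.prems signed_product_add_mset[OF x z, of S] x
    by (metis int_pow_1 int_pow_neg inv_inv insertI1 insertI2)
  then obtain gs \<epsilon> where gs: "mset gs = S" "\<And>i. i < length gs \<Longrightarrow> \<epsilon> i \<in> {1, -1 :: int}"
    "(\<Otimes>i\<in>{..<length gs}. gs ! i [^] \<epsilon> i) = z \<otimes> inv (x [^] e)"
    using add.IH[of "z \<otimes> inv (x [^] e)"] add.prems by auto
  have gc: "gs ! i \<in> carrier G" if "i < length gs" for i
    using that gs(1) add.prems by auto
  define \<epsilon>' where "\<epsilon>' i = (if i < length gs then \<epsilon> i else e)" for i
  have "(\<Otimes>i\<in>{..<length (gs @ [x])}. (gs @ [x]) ! i [^] \<epsilon>' i)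
      = x [^] e \<otimes> (\<Otimes>i\<in>{..<length gs}. (gs @ [x]) ! i [^] \<epsilon>' i)"
    using gc x by (simp add: lessThan_Suc, subst finprod_insert) (auto simp: nth_append \<epsilon>'_def)
  also have "(\<Otimes>i\<in>{..<length gs}. (gs @ [x]) ! i [^] \<epsilon>' i) = (\<Otimes>i\<in>{..<length gs}. gs ! i [^] \<epsilon> i)"
    using gc by (intro finprod_cong') (auto simp: nth_append \<epsilon>'_def)
  also have "x [^] e \<otimes> \<dots> = z"
    using gs(3) x z by (simp add: m_ac) 
  finally show ?case
    using gs e by (intro exI[of _ "gs @ [x]"] exI[of _ \<epsilon>']) (auto simp: \<epsilon>'_def)
qed (auto intro: exI[of _ "[]"])

lemma pm_zero_sum_iff_signed_product:
  assumes "set_mset S \<subseteq> carrier G"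
  shows "pm_zero_sum G S \<longleftrightarrow> signed_product S \<one>"
proof
  assume "pm_zero_sum G S"
  then obtain gs and \<epsilon> :: "nat \<Rightarrow> int" where gs: "mset gs = S" "\<forall>i<length gs. \<epsilon> i \<in> {1, -1}"
    "(\<Otimes>i\<in>{..<length gs}. gs ! i [^] \<epsilon> i) = \<one>"
    unfolding pm_zero_sum_def by blast
  have "gs ! i \<in> carrier G" if "i < length gs" for i
    using that gs(1) assms by auto
  then show "signed_product S \<one>"
    using signed_product_indices[of "{..<length gs}" "(!) gs" \<epsilon>] gs by (simp add: image_nth_mset_set)
next
  assume "signed_product S \<one>"
  then show "pm_zero_sum G S"
    using signed_product_obtain_signs[OF assms] unfolding pm_zero_sum_def by blast
qed

end

section \<open>Zero-sum multisets, their atoms and lengths\<close>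

context finite_abelian_group
begin

abbreviation zero_sums :: "'a multiset set" where
  "zero_sums \<equiv> carrier (pm_monoid G)"

lemma zero_sums_iff: "S \<in> zero_sums \<longleftrightarrow> set_mset S \<subseteq> carrier G \<and> signed_product S \<one>"
  using pm_zero_sum_iff_signed_product[of S] by (simp add: pm_monoid_def) blast

lemma zero_sums_empty [simp]: "{#} \<in> zero_sums"
  by (simp add: zero_sums_iff)

lemma zero_sums_plus: "S \<in> zero_sums \<Longrightarrow> T \<in> zero_sums \<Longrightarrow> S + T \<in> zero_sums"
  using signed_product_plus[of S \<one> T \<one>] by (auto simp: zero_sums_iff)

lemma zero_sums_double: "set_mset S \<subseteq> carrier G \<Longrightarrow> S + S \<in> zero_sums"
  using signed_product_plus[OF signed_product_mset_product[of S] signed_product_inv[OF signed_product_mset_product[of S]]]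
  by (auto simp: zero_sums_iff)

lemma zero_sums_image_mset:
  assumes "\<And>x. x \<in> carrier G \<Longrightarrow> \<sigma> x \<in> {x, inv x}" "set_mset S \<subseteq> carrier G"
  shows "image_mset \<sigma> S \<in> zero_sums \<longleftrightarrow> S \<in> zero_sums"
proof -
  have "\<sigma> x \<in> carrier G" if "x \<in> carrier G" for x
    using assms(1)[OF that] that by auto
  then have "\<sigma> ` set_mset S \<subseteq> carrier G" using assms(2) by blast
  then show ?thesis
    using signed_product_image_mset[OF assms(1) assms(2) one_closed] assms(2)
    by (simp add: zero_sums_iff)
qed

text \<open>
  The irreducible elements of \<open>pm_monoid G\<close>, stated without units and divisibility.
\<close>

definition atom :: "'a multiset \<Rightarrow> bool" where
  "atom U \<longleftrightarrow> U \<in> zero_sums \<and> U \<noteq> {#} \<and>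
     (\<forall>A\<in>zero_sums. \<forall>B\<in>zero_sums. U = A + B \<longrightarrow> A = {#} \<or> B = {#})"

lemma atomD: "atom (A + B) \<Longrightarrow> A \<in> zero_sums \<Longrightarrow> B \<in> zero_sums \<Longrightarrow> A = {#} \<or> B = {#}"
  unfolding atom_def by blast

lemma atom_zero_sum: "atom U \<Longrightarrow> U \<in> zero_sums"
  and atom_nonempty: "atom U \<Longrightarrow> U \<noteq> {#}"
  unfolding atom_def by auto

lemma atom_iff_irreducible:
  assumes "U \<in> zero_sums"
  shows "atom U \<longleftrightarrow> irreducible (pm_monoid G) U"
proof -
  have mult: "A \<otimes>\<^bsub>pm_monoid G\<^esub> B = A + B" and one: "\<one>\<^bsub>pm_monoid G\<^esub> = {#}" for A B
    by (simp_all add: pm_monoid_def)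
  have units: "S \<in> Units (pm_monoid G) \<longleftrightarrow> S = {#}" for S
    by (auto simp: Units_def mult one)
  have divides: "factor (pm_monoid G) A B \<longleftrightarrow> (\<exists>C\<in>zero_sums. B = A + C)" for A B
    by (auto simp: factor_def mult)
  have "properfactor (pm_monoid G) A U \<longleftrightarrow> (\<exists>C\<in>zero_sums. U = A + C \<and> C \<noteq> {#})" for A
    unfolding properfactor_def divides by (auto simp: ac_simps)
  then show ?thesis
    using assms unfolding atom_def irreducible_def units by blast
qed

lemma foldr_pm_monoid: "foldr (\<otimes>\<^bsub>pm_monoid G\<^esub>) fs \<one>\<^bsub>pm_monoid G\<^esub> = sum_list fs"
  by (simp add: pm_monoid_def sum_list.eq_foldr)

lemma set_of_lengths_eq:
  "set_of_lengths (pm_monoid G) V = {length fs | fs. (\<forall>U\<in>set fs. atom U) \<and> sum_list fs = V}"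
proof -
  have "set fs \<subseteq> zero_sums \<and> factors (pm_monoid G) fs V \<longleftrightarrow>
          (\<forall>U\<in>set fs. atom U) \<and> sum_list fs = V" for fs
    unfolding factors_def foldr_pm_monoid using atom_iff_irreducible atom_zero_sum by blast
  then show ?thesis
    unfolding set_of_lengths_def by blast
qed

lemma exists_factorization:
  assumes "V \<in> zero_sums"
  shows "\<exists>fs. (\<forall>U\<in>set fs. atom U) \<and> sum_list fs = V"
  using assms
proof (induction "size V" arbitrary: V rule: less_induct)
  case less
  show ?case
  proof (cases "V = {#} \<or> atom V")
    case True
    then show ?thesis
    proof
      assume "V = {#}"
      then show ?thesis by (intro exI[of _ "[]"]) simp
    next
      assume "atom V"
      then show ?thesis by (intro exI[of _ "[V]"]) simp
    qed
  next
    case False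
    then obtain A B where AB: "A \<in> zero_sums" "B \<in> zero_sums" "V = A + B" "A \<noteq> {#}" "B \<noteq> {#}"
      using less.prems unfolding atom_def by blast
    then have "size A < size V" "size B < size V" by (auto simp: nonempty_has_size)
    then obtain fs hs where "\<forall>U\<in>set fs. atom U" "sum_list fs = A" "\<forall>U\<in>set hs. atom U" "sum_list hs = B"
      using less.hyps AB by metis
    then show ?thesis using AB by (intro exI[of _ "fs @ hs"]) auto
  qed
qed

lemma atom_image_mset:
  assumes \<sigma>: "\<And>x. x \<in> carrier G \<Longrightarrow> \<sigma> x \<in> {x, inv x}" and U: "set_mset U \<subseteq> carrier G"
  shows "atom (image_mset \<sigma> U) \<longleftrightarrow> atom U"
proof -
  note iff = zero_sums_image_mset[OF \<sigma>]
  show ?thesis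
  proof
    assume *: "atom (image_mset \<sigma> U)"
    show "atom U"
      unfolding atom_def
    proof (intro conjI ballI impI)
      fix A B assume AB: "A \<in> zero_sums" "B \<in> zero_sums" "U = A + B"
      then have "image_mset \<sigma> A \<in> zero_sums" "image_mset \<sigma> B \<in> zero_sums"
        using U iff by auto
      then show "A = {#} \<or> B = {#}" using * AB(3) atomD by fastforce
    qed (use * iff[of U] U in \<open>auto dest: atom_zero_sum atom_nonempty\<close>)
  next
    assume *: "atom U"
    show "atom (image_mset \<sigma> U)"
      unfolding atom_def
    proof (intro conjI ballI impI)
      fix A B assume AB: "A \<in> zero_sums" "B \<in> zero_sums" "image_mset \<sigma> U = A + B"
      obtain A' B' where "U = A' + B'" "A = image_mset \<sigma> A'" "B = image_mset \<sigma> B'"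
        using image_mset_eq_plusD[OF AB(3)] by blast
      then show "A = {#} \<or> B = {#}" using * AB(1,2) U iff[of A'] iff[of B'] atomD by fastforce
    qed (use * iff[of U] U in \<open>auto dest: atom_zero_sum atom_nonempty\<close>)
  qed
qed

text \<open>
  Inverting some of the elements is compatible with factorizations in both directions: a factorization of the image lifts
  because a splitting of an image multiset comes from a splitting of the multiset.
\<close>

lemma set_of_lengths_image_mset:
  assumes \<sigma>: "\<And>x. x \<in> carrier G \<Longrightarrow> \<sigma> x \<in> {x, inv x}" and V: "set_mset V \<subseteq> carrier G"
  shows "set_of_lengths (pm_monoid G) (image_mset \<sigma> V) = set_of_lengths (pm_monoid G) V"
proof -
  have lift: "\<exists>fs'. map (image_mset \<sigma>) fs' = fs \<and> sum_list fs' = V" if "sum_list fs = image_mset \<sigma> V" for fs V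
    using that
  proof (induction fs arbitrary: V)
    case (Cons U fs)
    obtain U' V' where UV: "V = U' + V'" "U = image_mset \<sigma> U'" "sum_list fs = image_mset \<sigma> V'"
      using image_mset_eq_plusD[of \<sigma> V U "sum_list fs"] Cons.prems by auto
    then obtain fs' where "map (image_mset \<sigma>) fs' = fs" "sum_list fs' = V'"
      using Cons.IH by blast
    then show ?case using UV by (intro exI[of _ "U' # fs'"]) auto
  qed auto
  have push: "sum_list (map (image_mset \<sigma>) fs) = image_mset \<sigma> (sum_list fs)" for fs
    by (induction fs) auto
  have sub: "set_mset U \<subseteq> carrier G" if "sum_list fs = V" "U \<in> set fs" for U fs
  proof -
    show ?thesis using member_sum_list_subset[OF that(2)] V that(1) set_mset_mono by blast
  qed
  show ?thesis
  proof (intro equalityI subsetI)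
    fix k assume "k \<in> set_of_lengths (pm_monoid G) (image_mset \<sigma> V)"
    then obtain fs where fs: "k = length fs" "\<forall>U\<in>set fs. atom U" "sum_list fs = image_mset \<sigma> V"
      by (auto simp: set_of_lengths_eq)
    obtain fs' where fs': "map (image_mset \<sigma>) fs' = fs" "sum_list fs' = V"
      using lift[OF fs(3)] by blast
    have "atom U" if "U \<in> set fs'" for U
    proof -
      have "atom (image_mset \<sigma> U)" using that fs fs' by auto
      then show ?thesis using atom_image_mset[OF \<sigma> sub[OF fs'(2) that]] by blast
    qed
    then show "k \<in> set_of_lengths (pm_monoid G) V"
      using fs(1) fs' by (auto simp: set_of_lengths_eq intro!: exI[of _ fs'])
  next
    fix k assume "k \<in> set_of_lengths (pm_monoid G) V"
    then obtain fs where fs: "k = length fs" "\<forall>U\<in>set fs. atom U" "sum_list fs = V"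
      by (auto simp: set_of_lengths_eq)
    have "atom (image_mset \<sigma> U)" if "U \<in> set fs" for U
      using fs(2) that atom_image_mset[OF \<sigma> sub[OF fs(3) that]] by blast
    then show "k \<in> set_of_lengths (pm_monoid G) (image_mset \<sigma> V)"
      using push[of fs] fs by (auto simp: set_of_lengths_eq intro!: exI[of _ "map (image_mset \<sigma>) fs"])
  qed
qed

lemma zero_sums_sum_list: "(\<And>U. U \<in> set fs \<Longrightarrow> atom U) \<Longrightarrow> sum_list fs \<in> zero_sums"
  by (induction fs) (auto intro: zero_sums_plus atom_zero_sum)

lemma zero_sums_singleton: "x \<in> carrier G \<Longrightarrow> {#x#} \<in> zero_sums \<longleftrightarrow> x = \<one>"
  by (auto simp: zero_sums_iff signed_product_add_mset)

lemma atom_containing_one: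
  assumes "atom U" "\<one> \<in># U"
  shows "U = {#\<one>#}"
proof -
  obtain S where S: "U = add_mset \<one> S" using assms(2) by (metis mset_add)
  have "U \<in> zero_sums" using assms(1) by (rule atom_zero_sum)
  then have "S \<in> zero_sums"
    using S by (auto simp: zero_sums_iff signed_product_add_mset)
  then have "S = {#}"
    using assms(1) atomD[of "{#\<one>#}" S] S zero_sums_singleton[of \<one>] by auto
  then show ?thesis using S by simp
qed

lemma atom_size_ge_2:
  assumes "atom U" "\<one> \<notin># U"
  shows "2 \<le> size U"
proof (rule ccontr)
  assume "\<not> 2 \<le> size U"
  moreover have "size U \<noteq> 0" using atom_nonempty[OF assms(1)] by simp
  ultimately have "size U = 1" by linarith
  then obtain x where "U = {#x#}" using size_1_singleton_mset by blast
  then show False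
    using assms atom_zero_sum[OF assms(1)] zero_sums_singleton[of x] zero_sums_iff[of U] by auto
qed

lemma zero_sum_of_size_2:
  assumes "S \<in> zero_sums" "size S = 2"
  obtains x y where "S = {#x, y#}" "x \<in> carrier G" "y \<in> {x, inv x}"
proof -
  obtain x T where x: "S = add_mset x T" using assms(2) by (cases S) auto
  then have "size T = 1" using assms(2) by simp
  then obtain y where y: "T = {#y#}" using size_1_singleton_mset by blast
  have c: "x \<in> carrier G" "y \<in> carrier G" and "signed_product {#x, y#} \<one>"
    using assms(1) x y by (auto simp: zero_sums_iff)
  then have "x \<otimes> y = \<one> \<or> x \<otimes> inv y = \<one> \<or> inv x \<otimes> y = \<one> \<or> inv x \<otimes> inv y = \<one>"
    by (auto simp: signed_product_add_mset)
  then have "y \<in> {x, inv x}"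
    using c by (metis insertI1 insertI2 inv_closed inv_inv inv_unique' m_comm)
  then show ?thesis using that[of x y] x y c by simp
qed

text \<open>
  The singleton of \<open>\<one>\<close> is a prime element of the monoid. If it divides \<open>V\<close>, it occurs in every factorization, and after
  cancelling it, an atom would be a product of at least two atoms.
\<close>

lemma one_notin_if_two_and_more_factors:
  assumes "2 \<in> set_of_lengths (pm_monoid G) V" "k \<in> set_of_lengths (pm_monoid G) V" "2 < k"
  shows "\<one> \<notin># V"
proof
  assume one: "\<one> \<in># V"
  obtain fs where "length fs = 2" and fs: "\<And>U. U \<in> set fs \<Longrightarrow> atom U" "sum_list fs = V"
    using assms(1) by (auto simp: set_of_lengths_eq)
  then obtain A B where "fs = [A, B]" by (auto simp: numeral_2_eq_2 length_Suc_conv)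
  then have AB: "atom A" "atom B" "V = A + B" using fs by auto
  obtain U where U: "atom U" "V = {#\<one>#} + U"
  proof (cases "\<one> \<in># A")
    case True
    then show ?thesis using atom_containing_one[OF AB(1)] AB that[of B] by simp
  next
    case False
    then have "\<one> \<in># B" using one AB by simp
    then show ?thesis using atom_containing_one[OF AB(2)] AB that[of A] by simp
  qed
  obtain hs where hs: "length hs = k" "\<And>U. U \<in> set hs \<Longrightarrow> atom U" "sum_list hs = V"
    using assms(2) by (auto simp: set_of_lengths_eq)
  have "\<exists>h\<in>set hs. \<one> \<in># h"
    using one hs(3) by (induction hs arbitrary: V) auto
  then obtain h where h: "h \<in> set hs" "\<one> \<in># h" by blast
  then obtain as bs where split: "hs = as @ h # bs" by (meson split_list)
  have "h = {#\<one>#}" using atom_containing_one hs(2) h by blast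
  then have sum: "sum_list (as @ bs) = U" using hs(3) U(2) split by simp
  define ws where "ws = as @ bs"
  have "2 \<le> length ws" using hs(1) split assms(3) by (simp add: ws_def)
  then obtain a b cs where "ws = a # b # cs" by (cases ws; cases "tl ws") auto
  then have cs: "as @ bs = a # b # cs" by (simp add: ws_def)
  have atoms: "\<And>W. W \<in> set (a # b # cs) \<Longrightarrow> atom W" using hs(2) split cs by (metis Un_iff list.set_intros(2) set_append)
  then have "atom (a + (b + sum_list cs))" using U(1) sum cs by simp
  moreover have "b + sum_list cs \<in> zero_sums" using zero_sums_sum_list[of "b # cs"] atoms by auto
  moreover have "atom a" "atom b" using atoms by auto
  ultimately show False
    using atomD atom_zero_sum atom_nonempty by fastforce
qed

text \<open>
  Only the atom \<open>{#\<one>#}\<close> has size \<open>1\<close>. Without it, the size of \<open>V\<close> is at least twice the number of factors, with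
  equality only if all factors have size \<open>2\<close>.
\<close>

lemma factorization_sizes:
  assumes "\<one> \<notin># V" "\<And>U. U \<in> set fs \<Longrightarrow> atom U" "sum_list fs = V"
  shows "2 * length fs \<le> size V"
    and "size V \<le> 2 * length fs \<Longrightarrow> U \<in> set fs \<Longrightarrow> size U = 2"
proof -
  have "2 \<le> size U" if "U \<in> set fs" for U
    using that assms atom_size_ge_2[of U] member_sum_list_subset[OF that] by (metis mset_subset_eqD)
  then have *: "2 \<le> k" if "k \<in> set (map size fs)" for k
    using that by auto
  have size: "size V = sum_list (map size fs)"
    using assms(3) size_sum_list by blast
  show "2 * length fs \<le> size V"
    using sum_list_ge_twice_length(1)[of "map size fs"] * size by simp
  show "size V \<le> 2 * length fs \<Longrightarrow> U \<in> set fs \<Longrightarrow> size U = 2"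
    using sum_list_ge_twice_length(2)[of "map size fs" "size U"] * size by simp
qed

text \<open>
  Compare sizes: two atoms have total size at most \<open>2 * d\<close>, while \<open>k\<close> atoms other than \<open>{#\<one>#}\<close> have total size at
  least \<open>2 * k\<close>.
\<close>

lemma length_le_max_atom_size:
  assumes "\<And>U. atom U \<Longrightarrow> size U \<le> d"
    and "2 \<in> set_of_lengths (pm_monoid G) V" "k \<in> set_of_lengths (pm_monoid G) V" "2 < k"
  shows "k \<le> d" and "size V \<le> 2 * d"
proof -
  obtain fs where "length fs = 2" and fs: "\<And>U. U \<in> set fs \<Longrightarrow> atom U" "sum_list fs = V"
    using assms(2) by (auto simp: set_of_lengths_eq)
  then obtain A B where "fs = [A, B]" by (auto simp: numeral_2_eq_2 length_Suc_conv)
  then have "atom A" "atom B" "V = A + B" using fs by auto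
  then show size: "size V \<le> 2 * d" using assms(1)[of A] assms(1)[of B] by simp
  obtain hs where "length hs = k" "\<And>U. U \<in> set hs \<Longrightarrow> atom U" "sum_list hs = V"
    using assms(3) by (auto simp: set_of_lengths_eq)
  then have "2 * k \<le> size V"
    using factorization_sizes(1) one_notin_if_two_and_more_factors[OF assms(2-4)] by metis
  then show "k \<le> d" using size by simp
qed

text \<open>
  The Davenport constant argument: in a signed sequence longer than the order of the group, two of the proper partial products agree.
  The block between them has trivial product, and so has the rest of the sequence.
\<close>

lemma atom_size_le_order:
  assumes "atom U"
  shows "size U \<le> order G"
proof (rule ccontr)
  assume big: "\<not> size U \<le> order G"
  have U: "set_mset U \<subseteq> carrier G" "signed_product U \<one>"
    using atom_zero_sum[OF assms] by (auto simp: zero_sums_iff)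
  obtain gs and \<epsilon> :: "nat \<Rightarrow> int" where gs: "mset gs = U" "\<And>i. i < length gs \<Longrightarrow> \<epsilon> i \<in> {1, -1}"
    and prod: "(\<Otimes>i\<in>{..<length gs}. gs ! i [^] \<epsilon> i) = \<one>"
    using signed_product_obtain_signs[OF U] by blast
  define l where "l = length gs"
  define f where "f i = gs ! i [^] \<epsilon> i" for i
  have gc: "gs ! i \<in> carrier G" if "i < l" for i
    using that gs(1) U unfolding l_def by auto
  have fc: "f \<in> I \<rightarrow> carrier G" if "I \<subseteq> {..<l}" for I
    using that gc by (auto simp: f_def)
  have closed: "finprod G f I \<in> carrier G" if "I \<subseteq> {..<l}" for I
    using fc[OF that] by (rule finprod_closed)
  have "card {..<l} > card (carrier G)"
    using big gs(1) by (auto simp: l_def order_def)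
  moreover have "(\<lambda>j. finprod G f {..<j}) ` {..<l} \<subseteq> carrier G"
    by (auto intro!: closed)
  ultimately have "\<not> inj_on (\<lambda>j. finprod G f {..<j}) {..<l}"
    using finite_carrier card_inj_on_le by (metis linorder_not_less)
  then obtain i j where ij: "i < j" "j < l" "finprod G f {..<i} = finprod G f {..<j}"
    unfolding inj_on_def by (metis lessThan_iff linorder_neqE_nat)
  have Un: "finprod G f (I \<union> J) = finprod G f I \<otimes> finprod G f J"
    if "I \<subseteq> {..<l}" "J \<subseteq> {..<l}" "I \<inter> J = {}" for I J
    using that fc by (intro finprod_Un_disjoint) (auto intro: finite_subset)
  have zero_sum: "image_mset ((!) gs) (mset_set I) \<in> zero_sums" if "I \<subseteq> {..<l}" "finprod G f I = \<one>" for I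
  proof -
    have fin: "finite I" using that(1) finite_subset by blast
    then have "set_mset (image_mset ((!) gs) (mset_set I)) \<subseteq> carrier G"
      using that(1) gc by auto
    moreover have "signed_product (image_mset ((!) gs) (mset_set I)) (finprod G f I)"
      unfolding f_def using that(1) gc gs(2) fin by (intro signed_product_indices) (auto simp: l_def)
    ultimately show ?thesis using that(2) by (simp add: zero_sums_iff)
  qed
  define M where "M = {i..<j}"
  define R where "R = {..<i} \<union> {j..<l}"
  have sub: "M \<subseteq> {..<l}" "R \<subseteq> {..<l}" "{..<i} \<subseteq> {..<l}" and disj: "M \<inter> R = {}" "{..<i} \<inter> M = {}"
    using ij by (auto simp: M_def R_def)
  have "{..<j} = {..<i} \<union> M" using ij by (auto simp: M_def)
  then have "finprod G f {..<i} = finprod G f {..<i} \<otimes> finprod G f M"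
    using ij(3) Un[OF sub(3,1) disj(2)] by simp
  then have M1: "finprod G f M = \<one>"
    using closed sub by (metis l_cancel_one')
  have all: "{..<l} = M \<union> R" using ij by (auto simp: M_def R_def)
  then have "finprod G f R = \<one>"
    using Un[OF sub(1,2) disj(1)] M1 prod closed[OF sub(2)] by (simp add: f_def[abs_def] l_def)
  note zs = zero_sum[OF sub(1) M1] zero_sum[OF sub(2) this]
  have "mset_set {..<l} = mset_set M + mset_set R"
    unfolding all using disj by (intro mset_set_Union) (auto simp: M_def R_def)
  then have "U = image_mset ((!) gs) (mset_set M) + image_mset ((!) gs) (mset_set R)"
    using gs(1) image_nth_mset_set[of gs] by (simp add: l_def)
  moreover have "mset_set M \<noteq> {#}" "mset_set R \<noteq> {#}"
    using ij by (auto simp: M_def R_def mset_set_empty_iff)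
  ultimately show False
    using assms zs atomD by (metis image_mset_is_empty_iff)
qed

end

section \<open>Groups of odd order\<close>

locale odd_abelian_group = finite_abelian_group +
  assumes odd_order: "odd (order G)"
begin

lemma square_eq_one:
  assumes "x \<in> carrier G" "x \<otimes> x = \<one>"
  shows "x = \<one>"
proof -
  obtain k where k: "order G = 2 * k + 1" using odd_order by (elim oddE)
  have "\<one> = x [^] order G" using assms(1) by (simp add: pow_order_eq_1)
  also have "\<dots> = (x [^] (2::nat)) [^] k \<otimes> x"
    using assms(1) by (simp add: k nat_pow_pow)
  also have "x [^] (2::nat) = \<one>"
    using assms by (simp add: numeral_2_eq_2)
  finally show ?thesis using assms(1) by simp
qed

lemma square_inj:
  assumes "x \<in> carrier G" "y \<in> carrier G" "x \<otimes> x = y \<otimes> y"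
  shows "x = y"
proof -
  have "(x \<otimes> inv y) \<otimes> (x \<otimes> inv y) = (x \<otimes> x) \<otimes> inv (y \<otimes> y)"
    using assms(1,2) by (simp add: m_ac inv_mult)
  also have "\<dots> = \<one>" using assms by simp
  finally have "x \<otimes> inv y = \<one>" using square_eq_one[of "x \<otimes> inv y"] assms(1,2) by simp
  then show ?thesis using inv_equality[of x "inv y"] assms(1,2) by simp
qed

text \<open>
  Squaring is injective in a group of odd order, so relations with even exponents can be halved.
\<close>

lemma power_product_half:
  assumes "power_product (\<lambda>x. 2 * v x) = \<one>"
  shows "power_product v = \<one>"
proof -
  have "power_product v \<otimes> power_product v = \<one>"
    using assms power_product_add[of v v] by (simp only: mult_2)
  then show ?thesis by (rule square_eq_one[OF power_product_closed])
qed

lemma atom_double: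
  assumes "x \<in> carrier G" "x \<noteq> \<one>"
  shows "atom {#x, x#}"
  unfolding atom_def
proof (intro conjI ballI impI)
  show "{#x, x#} \<in> zero_sums" using zero_sums_double[of "{#x#}"] assms by simp
  fix A B assume AB: "A \<in> zero_sums" "B \<in> zero_sums" "{#x, x#} = A + B"
  show "A = {#} \<or> B = {#}"
  proof (rule ccontr)
    assume "\<not> (A = {#} \<or> B = {#})"
    then have "size A \<noteq> 0" "size B \<noteq> 0" by auto
    moreover have "size A + size B = 2" using arg_cong[OF AB(3), of size] by simp
    ultimately have "size A = 1" by linarith
    then obtain y where y: "A = {#y#}" using size_1_singleton_mset by blast
    then have "y = x" using arg_cong[OF AB(3), of set_mset] by auto
    then show False using AB(1) y assms zero_sums_singleton by simp
  qed
qed simp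

lemma atom_even_counts:
  assumes "atom U" "\<one> \<notin># U" "\<And>x. even (count U x)"
  shows "size U = 2"
proof -
  obtain W where W: "\<forall>x. count W x = count U x div 2"
    using exists_multiset_with_counts[of "\<lambda>x. count U x div 2" U] by auto
  have U: "U = W + W"
  proof (rule multiset_eqI)
    fix x
    show "count U x = count (W + W) x" using W assms(3)[of x] by (auto elim: evenE)
  qed
  have c: "set_mset U \<subseteq> carrier G" using atom_zero_sum[OF assms(1)] by (simp add: zero_sums_iff)
  obtain x X where x: "W = add_mset x X" using U atom_nonempty[OF assms(1)] by (cases W) auto
  have "atom {#x, x#}" using atom_double[of x] assms(2) c U x by auto
  moreover have "X + X \<in> zero_sums" using zero_sums_double c U x by auto
  ultimately have "X + X = {#}"
    using assms(1) atomD[of "{#x, x#}" "X + X"] U x atom_zero_sum by auto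
  then show ?thesis using U x by simp
qed

lemma lengths_of_atom_square:
  assumes "atom U" "\<one> \<notin># U"
  shows "2 \<in> set_of_lengths (pm_monoid G) (U + U)" "size U \<in> set_of_lengths (pm_monoid G) (U + U)"
proof -
  show "2 \<in> set_of_lengths (pm_monoid G) (U + U)"
    using assms by (auto simp: set_of_lengths_eq intro!: exI[of _ "[U, U]"])
  obtain gs where gs: "mset gs = U" using ex_mset by blast
  have "sum_list (map (\<lambda>x. {#x, x#}) gs) = mset gs + mset gs"
    by (induction gs) auto
  moreover have "atom {#x, x#}" if "x \<in># U" for x
    using that assms atom_zero_sum[OF assms(1)] by (intro atom_double) (auto simp: zero_sums_iff)
  ultimately show "size U \<in> set_of_lengths (pm_monoid G) (U + U)"
    using gs by (auto simp: set_of_lengths_eq intro!: exI[of _ "map (\<lambda>x. {#x, x#}) gs"])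
qed

end

section \<open>Bounded relations and tight multisets\<close>

context odd_abelian_group
begin

text \<open>
  A relation with only even exponents is halved, which makes the sum of absolute values smaller. Otherwise \<open>\<bar>w\<bar>\<close>
  is the multiplicity function of a zero-sum multiset \<open>W \<subseteq># U\<close>, and \<open>U + U\<close> is \<open>W\<close> plus the
  zero-sum multiset \<open>W + 2 (U - W)\<close>. Factoring both parts gives a factorization of \<open>U + U\<close>. If its length is
  \<open>size U\<close>, all factors are squares \<open>{#x, x#}\<close>, contradicting an odd exponent; if it is \<open>2\<close>, both
  parts are atoms and the bound on their sizes leaves only \<open>W = U\<close>.
\<close>

lemma bounded_relation_saturated:
  assumes max: "\<And>A. atom A \<Longrightarrow> size A \<le> size U"
    and L: "set_of_lengths (pm_monoid G) (U + U) = {2, size U}"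
    and U: "set_mset U \<subseteq> carrier G" "\<one> \<notin># U"
    and reduced: "\<And>x. x \<in># U \<Longrightarrow> inv x \<in># U \<Longrightarrow> inv x = x"
    and w: "power_product w = \<one>" "\<And>x. \<bar>w x\<bar> \<le> int (count U x)" "w \<noteq> (\<lambda>x. 0)"
  shows "\<bar>w x\<bar> = int (count U x)"
  using w
proof (induction "\<Sum>x\<in>set_mset U. nat \<bar>w x\<bar>" arbitrary: w x rule: less_induct)
  case less
  note bound = less.prems(2)
  obtain x0 where x0: "w x0 \<noteq> 0" using less.prems(3) by auto
  then have "count U x0 \<noteq> 0" using bound[of x0] by linarith
  then have x0U: "x0 \<in># U" by simp
  show ?case
  proof (cases "\<forall>x. even (w x)")
    case True
    define v where "v x = w x div 2" for x
    have wv: "w = (\<lambda>x. 2 * v x)" using True by (auto simp: v_def)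
    have "nat \<bar>v x\<bar> \<le> nat \<bar>w x\<bar>" for x by (simp add: wv)
    moreover have "nat \<bar>v x0\<bar> < nat \<bar>w x0\<bar>" using x0 by (simp add: wv)
    ultimately have "(\<Sum>x\<in>set_mset U. nat \<bar>v x\<bar>) < (\<Sum>x\<in>set_mset U. nat \<bar>w x\<bar>)"
      using x0U by (intro sum_strict_mono_ex1) auto
    moreover have "power_product v = \<one>" using less.prems(1) wv power_product_half by blast
    moreover have "\<bar>v x\<bar> \<le> int (count U x)" for x using bound[of x] by (simp add: wv)
    moreover have "v \<noteq> (\<lambda>x. 0)" using x0 wv by auto
    ultimately have "\<bar>v x0\<bar> = int (count U x0)" using less.hyps by blast
    then show ?thesis using bound[of x0] x0 by (simp add: wv)
  next
    case False
    then obtain x1 where x1: "odd (w x1)" by blast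
    obtain W where W: "\<And>x. count W x = nat \<bar>w x\<bar>"
      using exists_multiset_with_counts[of "\<lambda>x. nat \<bar>w x\<bar>" U] bound by (auto simp: nat_le_iff)
    have WU: "W \<subseteq># U" using W bound by (auto simp: subseteq_mset_def nat_le_iff)
    then obtain D where D: "U = W + D" using subset_mset.le_iff_add by blast
    define R where "R = W + (D + D)"
    have Wzs: "W \<in> zero_sums"
      using WU U less.prems(1) W set_mset_mono[OF WU]
      by (auto simp: zero_sums_iff intro!: signed_productI[of w])
    then have Rzs: "R \<in> zero_sums"
      unfolding R_def using D U by (intro zero_sums_plus zero_sums_double) auto
    have UU: "U + U = W + R" using D by (simp add: R_def ac_simps)
    obtain fs where fs: "\<And>A. A \<in> set fs \<Longrightarrow> atom A" "sum_list fs = W"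
      using exists_factorization[OF Wzs] by blast
    obtain hs where hs: "\<And>A. A \<in> set hs \<Longrightarrow> atom A" "sum_list hs = R"
      using exists_factorization[OF Rzs] by blast
    have all: "\<And>A. A \<in> set (fs @ hs) \<Longrightarrow> atom A" "sum_list (fs @ hs) = U + U"
      using fs hs UU by auto
    then have "length (fs @ hs) \<in> set_of_lengths (pm_monoid G) (U + U)"
      unfolding set_of_lengths_eq by blast
    then consider "length (fs @ hs) = size U" | "length fs + length hs = 2"
      using L by auto
    then show ?thesis
    proof cases
      case 1
      \<comment> \<open>All factors have the form \<open>{#x, x#}\<close>, so every multiplicity in \<open>W\<close> is even.\<close>
      have "even (count A y)" if A: "A \<in> set fs" for A y
      proof -
        have "size A = 2"
          using factorization_sizes(2)[of "U + U" "fs @ hs" A] all U(2) 1 A by simp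
        then obtain a b where ab: "A = {#a, b#}" "a \<in> carrier G" "b \<in> {a, inv a}"
          by (rule zero_sum_of_size_2[OF atom_zero_sum[OF fs(1)[OF A]]])
        have "A \<subseteq># W" using member_sum_list_subset[OF A] fs(2) by simp
        then have "A \<subseteq># U" using WU by (rule subset_mset.order_trans)
        then have "a \<in># U" "b \<in># U" using ab by (auto dest: mset_subset_eqD)
        then have "b = a" using ab(3) reduced by auto
        then show ?thesis using ab by simp
      qed
      then have "even (count (sum_list fs) x1)"
        by (induction fs) auto
      then show ?thesis using x1 W fs(2) by (simp add: even_nat_iff)
    next
      case 2
      \<comment> \<open>Both \<open>W\<close> and \<open>R\<close> are atoms, and the bound on the size of \<open>R\<close> forces \<open>W = U\<close>.\<close>
      have "count W x1 \<noteq> 0" using x1 W by auto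
      then have "W \<noteq> {#}" by auto
      then have "R \<noteq> {#}" by (simp add: R_def)
      then have "fs \<noteq> []" "hs \<noteq> []" using fs hs \<open>W \<noteq> {#}\<close> by auto
      then have "length hs = 1" using 2 by (cases fs; cases hs) auto
      then obtain A where "hs = [A]" by (auto simp: length_Suc_conv)
      then have "atom R" using hs by auto
      then have "size R \<le> size U" by (rule max)
      moreover have "size W + size R = 2 * size U" using arg_cong[OF UU, of size] by simp
      ultimately have "D = {#}" using arg_cong[OF D, of size] by simp
      then show ?thesis using D W[of x] by simp
    qed
  qed
qed

text \<open>
  Let \<open>v\<close> and \<open>w\<close> be the sign sums of two atoms with \<open>A + B = U + U\<close>. They agree modulo \<open>2\<close>, so half their
  sum and half their difference are relations, and both are bounded by half of \<open>count A + count B\<close>, that is, by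
  \<open>count U\<close>. They cannot both vanish, as then all multiplicities in \<open>A\<close> and \<open>B\<close> would be even.
\<close>

lemma exists_nonzero_bounded_relation:
  assumes L: "2 \<in> set_of_lengths (pm_monoid G) (U + U)" and U: "\<one> \<notin># U" "3 \<le> size U"
  shows "\<exists>w. power_product w = \<one> \<and> (\<forall>x. \<bar>w x\<bar> \<le> int (count U x)) \<and> w \<noteq> (\<lambda>x. 0)"
proof -
  obtain fs where "length fs = 2" and fs: "\<And>A. A \<in> set fs \<Longrightarrow> atom A" "sum_list fs = U + U"
    using L by (auto simp: set_of_lengths_eq)
  then obtain A B where "fs = [A, B]" by (auto simp: numeral_2_eq_2 length_Suc_conv)
  then have A: "atom A" and B: "atom B" and AB: "A + B = U + U" using fs by auto
  obtain v where v: "power_product v = \<one>" "\<And>x. \<bar>v x\<bar> \<le> int (count A x)" "\<And>x. even (int (count A x) + v x)"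
    using atom_zero_sum[OF A] unfolding zero_sums_iff by (auto elim: signed_productE)
  obtain w where w: "power_product w = \<one>" "\<And>x. \<bar>w x\<bar> \<le> int (count B x)" "\<And>x. even (int (count B x) + w x)"
    using atom_zero_sum[OF B] unfolding zero_sums_iff by (auto elim: signed_productE)
  have count: "int (count A x) + int (count B x) = 2 * int (count U x)" for x
    using arg_cong[OF AB, of "\<lambda>S. count S x"] by simp
  have even: "even (v x + w x)" "even (v x - w x)" for x
    using v(3)[of x] w(3)[of x] count[of x] by presburger+
  define y where "y x = (v x + w x) div 2" for x
  define z where "z x = (v x - w x) div 2" for x
  have y2: "2 * y x = v x + w x" and z2: "2 * z x = v x - w x" for x
    using even[of x] by (auto simp: y_def z_def)
  have "power_product y = \<one>"
    by (rule power_product_half) (simp add: y2 power_product_add v w)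
  moreover have "power_product z = \<one>"
    by (rule power_product_half) (simp add: z2 power_product_diff v w)
  moreover have "\<bar>y x\<bar> \<le> int (count U x)" "\<bar>z x\<bar> \<le> int (count U x)" for x
    using v(2)[of x] w(2)[of x] count[of x] y2[of x] z2[of x] by linarith+
  moreover have "y \<noteq> (\<lambda>x. 0) \<or> z \<noteq> (\<lambda>x. 0)"
  proof (rule ccontr)
    assume "\<not> ?thesis"
    then have yz: "y x = 0" "z x = 0" for x by auto
    have "v x = 0" "w x = 0" for x
      using y2[of x] z2[of x] yz[of x] by linarith+
    then have ev: "even (count A x)" "even (count B x)" for x using v(3)[of x] w(3)[of x] by auto
    have "\<one> \<notin># A + B" using AB U(1) by simp
    then have "size A = 2" "size B = 2" using atom_even_counts A B ev by auto
    then show False using arg_cong[OF AB, of size] U(2) by simp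
  qed
  ultimately show ?thesis by blast
qed

text \<open>
  By the condition on the product, the multiplicities are themselves a relation; the last condition makes it, up to sign,
  the only nonzero one of at most this size.
\<close>

definition tight :: "'a multiset \<Rightarrow> bool" where
  "tight U \<longleftrightarrow> set_mset U \<subseteq> carrier G \<and> mset_product U = \<one> \<and>
     (\<forall>w. power_product w = \<one> \<and> (\<forall>x. \<bar>w x\<bar> \<le> int (count U x)) \<longrightarrow>
        w = (\<lambda>x. 0) \<or> w = (\<lambda>x. int (count U x)) \<or> w = (\<lambda>x. - int (count U x)))"

text \<open>
  For a saturated relation \<open>w\<close>, the vector \<open>(count U - w) / 2\<close> is again a bounded relation. It has entries \<open>0\<close> where
  \<open>w\<close> is positive and \<open>count U\<close> where \<open>w\<close> is negative; being zero or saturated, it excludes mixed signs.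
\<close>

lemma tight_if_saturated:
  assumes U: "set_mset U \<subseteq> carrier G" "mset_product U = \<one>"
    and sat: "\<And>w x. power_product w = \<one> \<Longrightarrow> (\<And>x. \<bar>w x\<bar> \<le> int (count U x)) \<Longrightarrow> w \<noteq> (\<lambda>x. 0) \<Longrightarrow>
                \<bar>w x\<bar> = int (count U x)"
  shows "tight U"
  unfolding tight_def
proof (intro conjI allI impI)
  fix w assume "power_product w = \<one> \<and> (\<forall>x. \<bar>w x\<bar> \<le> int (count U x))"
  then have w: "power_product w = \<one>" "\<And>x. \<bar>w x\<bar> \<le> int (count U x)" by auto
  show "w = (\<lambda>x. 0) \<or> w = (\<lambda>x. int (count U x)) \<or> w = (\<lambda>x. - int (count U x))"
  proof (cases "w = (\<lambda>x. 0)")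
    case False
    have full: "\<bar>w x\<bar> = int (count U x)" for x using sat w False by blast
    define v where "v x = (int (count U x) - w x) div 2" for x
    have v: "2 * v x = int (count U x) - w x" for x
    proof -
      have "w x = int (count U x) \<or> w x = - int (count U x)" using full[of x] by linarith
      then show ?thesis by (auto simp: v_def)
    qed
    have "power_product v = \<one>"
      by (rule power_product_half) (use U(2) w(1) in \<open>simp add: v power_product_diff mset_product_def\<close>)
    moreover have "\<bar>v x\<bar> \<le> int (count U x)" for x using v[of x] full[of x] by linarith
    ultimately have "\<bar>v x\<bar> = int (count U x)" if "v \<noteq> (\<lambda>x. 0)" for x using sat that by blast
    then have cases: "v = (\<lambda>x. 0) \<or> (\<forall>x. \<bar>v x\<bar> = int (count U x))" by blast
    then show ?thesis
    proof
      assume *: "v = (\<lambda>x. 0)"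
      have "w x = int (count U x)" for x using v[of x] * by simp
      then show ?thesis by blast
    next
      assume *: "\<forall>x. \<bar>v x\<bar> = int (count U x)"
      have "w x = - int (count U x)" for x using v[of x] *[rule_format, of x] full[of x] by linarith
      then show ?thesis by blast
    qed
  qed simp
qed (use U in auto)

text \<open>
  A representative of each pair \<open>{x, inv x}\<close>. Applying it turns a zero-sum multiset of size \<open>2\<close> into a square
  \<open>{#y, y#}\<close>.
\<close>

lemma exists_sign_representatives:
  "\<exists>\<rho>. (\<forall>x\<in>carrier G. \<rho> x \<in> {x, inv x} \<and> \<rho> (inv x) = \<rho> x)"
proof -
  define \<rho> where "\<rho> x = (SOME y. y \<in> {x, inv x})" for x
  have "\<rho> x \<in> {x, inv x}" for x
    unfolding \<rho>_def by (rule someI[of _ x]) simp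
  moreover have "\<rho> (inv x) = \<rho> x" if "x \<in> carrier G" for x
    using that by (simp add: \<rho>_def insert_commute)
  ultimately show ?thesis by blast
qed

text \<open>
  After passing to sign representatives, \<open>V\<close> becomes \<open>T + T\<close> because of its factorization into \<open>n\<close> atoms of size
  \<open>2\<close>. There is a nonzero bounded relation \<open>c\<close> for \<open>T\<close>, and it is saturated; inverting the elements with
  negative exponent in \<open>c\<close> gives a multiset whose own product is trivial.
\<close>

lemma exists_tight:
  assumes max: "\<And>A. atom A \<Longrightarrow> size A \<le> n"
    and V: "V \<in> zero_sums" "set_of_lengths (pm_monoid G) V = {2, n}" and n: "3 \<le> n"
  shows "\<exists>U. tight U \<and> size U = n"
proof -
  have Vc: "set_mset V \<subseteq> carrier G" using V(1) by (simp add: zero_sums_iff)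
  obtain \<rho> where \<rho>: "\<And>x. x \<in> carrier G \<Longrightarrow> \<rho> x \<in> {x, inv x}" "\<And>x. x \<in> carrier G \<Longrightarrow> \<rho> (inv x) = \<rho> x"
    using exists_sign_representatives by blast
  have one: "\<one> \<notin># V" using one_notin_if_two_and_more_factors[of V n] V(2) n by simp
  have sizeV: "size V \<le> 2 * n" using length_le_max_atom_size(2)[of n V n] max V(2) n by simp
  obtain fs where fs: "length fs = n" "\<And>A. A \<in> set fs \<Longrightarrow> atom A" "sum_list fs = V"
  proof -
    have "n \<in> set_of_lengths (pm_monoid G) V" using V(2) by simp
    then show ?thesis using that by (auto simp: set_of_lengths_eq)
  qed
  have "\<exists>x. image_mset \<rho> A = {#x#} + {#x#}" if A: "A \<in> set fs" for A
  proof -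
    have "size A = 2"
      using factorization_sizes(2)[of V fs A] one fs sizeV A by simp
    then obtain x y where xy: "A = {#x, y#}" "x \<in> carrier G" "y \<in> {x, inv x}"
      by (rule zero_sum_of_size_2[OF atom_zero_sum[OF fs(2)[OF A]]])
    then have "\<rho> y = \<rho> x" using \<rho>(2) by auto
    then show ?thesis using xy by (intro exI[of _ "\<rho> x"]) simp
  qed
  then have "\<exists>T. image_mset \<rho> (sum_list fs) = T + T"
  proof (induction fs)
    case (Cons A fs)
    obtain x where x: "image_mset \<rho> A = {#x#} + {#x#}" using Cons.prems[of A] by auto
    obtain T where "image_mset \<rho> (sum_list fs) = T + T" using Cons by auto
    then show ?case using x by (intro exI[of _ "{#x#} + T"]) simp
  qed auto
  then obtain T where T: "image_mset \<rho> V = T + T" using fs(3) by auto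
  have sizeT: "size T = n"
  proof -
    have "2 * n \<le> size V" using factorization_sizes(1)[of V fs] one fs by simp
    then show ?thesis using sizeV arg_cong[OF T, of size] by simp
  qed
  have LT: "set_of_lengths (pm_monoid G) (T + T) = {2, size T}"
    using set_of_lengths_image_mset[OF \<rho>(1) Vc] V(2) T sizeT by simp
  have \<rho>T: "\<exists>y\<in>carrier G. x = \<rho> y" if "x \<in># T" for x
  proof -
    have "x \<in># image_mset \<rho> V" using T that by simp
    then show ?thesis using Vc by auto
  qed
  have \<rho>c: "\<rho> y \<in> carrier G" and \<rho>\<rho>: "\<rho> (\<rho> y) = \<rho> y" if "y \<in> carrier G" for y
    using \<rho>(1)[OF that] \<rho>(2)[OF that] that by auto
  have Tc: "set_mset T \<subseteq> carrier G" using \<rho>T \<rho>c by blast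
  have \<rho>id: "\<rho> x = x" if "x \<in># T" for x using \<rho>T[OF that] \<rho>\<rho> by auto
  have redT: "inv x = x" if "x \<in># T" "inv x \<in># T" for x
    using \<rho>id[OF that(1)] \<rho>id[OF that(2)] \<rho>(2)[of x] Tc that(1) by auto
  have one_iff: "\<one> \<notin># image_mset \<sigma> S"
    if "\<And>x. x \<in> carrier G \<Longrightarrow> \<sigma> x \<in> {x, inv x}" "set_mset S \<subseteq> carrier G" "\<one> \<notin># S" for \<sigma> S
    using that by (auto simp: image_iff) (metis inv_eq_1_iff insertE singletonD subsetD)
  have oneT: "\<one> \<notin># T" using one_iff[OF \<rho>(1) Vc one] T by simp
  have 2: "2 \<in> set_of_lengths (pm_monoid G) (T + T)" using LT by simp
  obtain c where c: "power_product c = \<one>" "\<And>x. \<bar>c x\<bar> \<le> int (count T x)" "c \<noteq> (\<lambda>x. 0)"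
    using exists_nonzero_bounded_relation[OF 2 oneT] n sizeT by auto
  have maxT: "\<And>A. atom A \<Longrightarrow> size A \<le> size T" using max sizeT by simp
  have full: "\<bar>c x\<bar> = int (count T x)" for x
    using bounded_relation_saturated[OF maxT LT Tc oneT redT c] by blast
  \<comment> \<open>Invert the elements with negative exponent in the relation \<open>c\<close>.\<close>
  define \<phi> where "\<phi> x = (if c x < 0 then inv x else x)" for x
  have \<phi>: "\<phi> x \<in> {x, inv x}" for x by (simp add: \<phi>_def)
  define U where "U = image_mset \<phi> T"
  obtain A where A: "\<And>x. count A x = nat (c x)"
    using exists_multiset_with_counts[of "\<lambda>x. nat (c x)" T] c(2) by (fastforce simp: nat_le_iff abs_le_iff)
  obtain B where B: "\<And>x. count B x = nat (- c x)"
    using exists_multiset_with_counts[of "\<lambda>x. nat (- c x)" T] c(2) by (fastforce simp: nat_le_iff abs_le_iff)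
  have TAB: "T = A + B"
  proof (rule multiset_eqI)
    fix x show "count T x = count (A + B) x" using full[of x] A[of x] B[of x] by simp
  qed
  have "image_mset \<phi> A = A"
  proof -
    have "\<phi> x = x" if "x \<in># A" for x
      using that A[of x] by (auto simp: \<phi>_def count_greater_zero_iff[symmetric] simp del: count_greater_zero_iff)
    then show ?thesis by (simp cong: image_mset_cong)
  qed
  moreover have "image_mset \<phi> B = image_mset (\<lambda>x. inv x) B"
  proof (rule image_mset_cong)
    fix x assume "x \<in># B"
    then show "\<phi> x = inv x"
      using B[of x] by (auto simp: \<phi>_def count_greater_zero_iff[symmetric] simp del: count_greater_zero_iff)
  qed
  ultimately have "mset_product U = mset_product A \<otimes> inv (mset_product B)"
    using Tc by (simp add: U_def TAB mset_product_plus mset_product_inv)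
  also have "\<dots> = power_product (\<lambda>x. int (count A x) - int (count B x))"
    by (simp add: mset_product_def power_product_diff)
  also have "(\<lambda>x. int (count A x) - int (count B x)) = c"
    using A B by (auto simp: fun_eq_iff)
  finally have prodU: "mset_product U = \<one>" using c(1) by simp
  have sizeU: "size U = n" using sizeT by (simp add: U_def)
  have Uc: "set_mset U \<subseteq> carrier G" using Tc by (auto simp: U_def \<phi>_def)
  have LU: "set_of_lengths (pm_monoid G) (U + U) = {2, size U}"
    using set_of_lengths_image_mset[of \<phi> "T + T"] \<phi> Tc LT sizeT sizeU by (simp add: U_def)
  have oneU: "\<one> \<notin># U" unfolding U_def using one_iff[of \<phi> T] \<phi> Tc oneT by blast
  have redU: "inv x = x" if "x \<in># U" "inv x \<in># U" for x
  proof -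
    obtain y z where yz: "y \<in># T" "x = \<phi> y" "z \<in># T" "inv x = \<phi> z" using \<open>x \<in># U\<close> \<open>inv x \<in># U\<close> by (auto simp: U_def)
    have "y \<in> carrier G" "z \<in> carrier G" using yz Tc by auto
    then have "z = y \<or> z = inv y"
      using yz \<phi>[of y] \<phi>[of z] by auto
    then have "z = y" using redT yz by auto
    then show ?thesis using yz by simp
  qed
  have maxU: "\<And>A. atom A \<Longrightarrow> size A \<le> size U" using max sizeU by simp
  have "tight U"
    using Uc prodU bounded_relation_saturated[OF maxU LU Uc oneU redU] by (intro tight_if_saturated) blast+
  then show ?thesis using sizeU by blast
qed

end

section \<open>A maximal tight multiset has one distinct element\<close>

context odd_abelian_group
begin

lemma tight_bounded_relation:
  assumes "tight U" "power_product w = \<one>" "\<And>x. \<bar>w x\<bar> \<le> int (count U x)"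
  shows "w = (\<lambda>x. 0) \<or> w = (\<lambda>x. int (count U x)) \<or> w = (\<lambda>x. - int (count U x))"
  using assms unfolding tight_def by blast

text \<open>
  Otherwise half of the multiplicities would be another nonzero bounded relation.
\<close>

lemma tight_has_odd_count:
  assumes "tight U" "U \<noteq> {#}"
  shows "\<exists>x. odd (count U x)"
proof (rule ccontr)
  assume "\<not> ?thesis"
  then have even: "even (count U x)" for x by blast
  define v where "v x = int (count U x div 2)" for x
  have v: "2 * v x = int (count U x)" for x
    using even[of x] by (auto simp: v_def elim: evenE)
  have "power_product v = \<one>"
    by (rule power_product_half) (use assms(1) in \<open>simp add: v tight_def mset_product_def\<close>)
  moreover have "\<bar>v x\<bar> \<le> int (count U x)" for x using v[of x] by linarith
  ultimately have "v = (\<lambda>x. 0) \<or> v = (\<lambda>x. int (count U x)) \<or> v = (\<lambda>x. - int (count U x))"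
    using tight_bounded_relation[OF assms(1)] by blast
  then have "int (count U x) = 0" for x
    using v[of x] by auto
  then have "U = {#}" by (intro multiset_eqI) simp
  then show False using assms(2) by simp
qed

text \<open>
  The parity condition says that \<open>w\<close> comes from a choice of signs on all of \<open>U\<close>; it rules out \<open>w = 0\<close>.
\<close>

lemma tight_signed_relation:
  assumes "tight U" "U \<noteq> {#}" "power_product w = \<one>" "\<And>x. \<bar>w x\<bar> \<le> int (count U x)"
    and "\<And>x. even (int (count U x) + w x)"
  shows "w = (\<lambda>x. int (count U x)) \<or> w = (\<lambda>x. - int (count U x))"
proof -
  have "w \<noteq> (\<lambda>x. 0)" using tight_has_odd_count[OF assms(1,2)] assms(5) by auto
  then show ?thesis using tight_bounded_relation assms by blast
qed

text \<open>
  Suppose that the new multiset splits into nonempty zero-sum parts. Unless \<open>x\<close> turns out to be a power product with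
  exponents between \<open>0\<close> and \<open>count D\<close>, the signs of the two parts combine to a relation that is bounded by
  \<open>U = add_mset g D\<close> and has the parity of \<open>count U\<close>. By tightness it is \<open>\<plusminus>count U\<close>, which either
  contradicts the shape of the splitting or again yields such exponents for \<open>x\<close>.
\<close>

lemma exchange_in_tight_is_atom:
  assumes tight: "tight (add_mset g D)" and x: "x \<in> carrier G"
    and uncovered: "\<And>t. power_product t = x \<Longrightarrow> (\<And>z. 0 \<le> t z) \<Longrightarrow> (\<And>z. t z \<le> int (count D z)) \<Longrightarrow> False"
  shows "atom (add_mset x (add_mset (x \<otimes> g) D))"
proof -
  define y where "y = x \<otimes> g"
  define \<delta> where "\<delta> z = (if z = g then 1 else 0 :: int)" for z
  have c: "g \<in> carrier G" "set_mset D \<subseteq> carrier G" "y \<in> carrier G"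
    using tight x by (auto simp: tight_def y_def)
  have count: "int (count (add_mset g D) z) = int (count D z) + \<delta> z" for z
    by (simp add: \<delta>_def)
  have power_product_\<delta>: "power_product \<delta> = g"
    unfolding \<delta>_def[abs_def] using c by (simp add: power_product_single)
  have "g \<otimes> mset_product D = \<one>" using tight c by (simp add: tight_def mset_product_add_mset)
  then have prodD: "mset_product D = inv g" using c by (metis inv_unique' m_comm mset_product_closed)
  note signed = tight_signed_relation[OF tight add_mset_not_empty, unfolded count]
  \<comment> \<open>A relation on a part of \<open>D\<close> is not saturated at \<open>g\<close>, hence zero, so all multiplicities are even.\<close>
  have even_D: "even (count B z)" if "B \<in> zero_sums" "B \<subseteq># D" for B z
  proof -
    have "signed_product B \<one>" using that(1) by (simp add: zero_sums_iff)
    then obtain b where b: "power_product b = \<one>" "\<And>z. \<bar>b z\<bar> \<le> int (count B z)" "\<And>z. even (int (count B z) + b z)"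
      by (rule signed_productE) blast
    have le: "\<bar>b z\<bar> \<le> int (count D z)" for z
      using b(2)[of z] mset_subset_eq_count[OF that(2), of z] by linarith
    have "\<bar>b z\<bar> \<le> int (count (add_mset g D) z)" for z
      using le[of z] by simp
    moreover have "\<bar>b g\<bar> < int (count (add_mset g D) g)" using le[of g] by simp
    ultimately have "b = (\<lambda>z. 0)"
      using tight_bounded_relation[OF tight b(1)] by fastforce
    then show ?thesis using b(3)[of z] by simp
  qed
  \<comment> \<open>With equal signs, \<open>x \<otimes> y\<close> is a signed product of \<open>A\<close>, and averaging its exponents with \<open>count D\<close>
    gives exponents for \<open>x\<close>. With opposite signs, \<open>x\<close> and \<open>y\<close> act like one copy of \<open>g\<close>, which gives a signed
    relation on \<open>add_mset g A\<close>; it is saturated on \<open>U\<close> only if \<open>B\<close> is empty.\<close>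
  have same: "B = {#}" if A: "add_mset x (add_mset y A) \<in> zero_sums" and B: "B \<in> zero_sums" and D: "D = A + B"
    for A B
  proof -
    have evenB: "even (int (count B z))" for z using even_D[OF B] D by simp
    have cD: "int (count D z) = int (count A z) + int (count B z)" for z by (simp add: D)
    have "signed_product (add_mset x (add_mset y A)) \<one>" using A by (simp add: zero_sums_iff)
    then consider s where "s \<in> {x \<otimes> y, inv (x \<otimes> y)}" "signed_product A s"
      | s where "s \<in> {inv x \<otimes> y, inv (inv x \<otimes> y)}" "signed_product A s"
      using x c by (auto simp: signed_product_add_mset inv_mult)
    then have "signed_product A (x \<otimes> y) \<or> signed_product A (inv x \<otimes> y)"
      using signed_product_inv x c by cases (metis inv_closed inv_inv m_closed insertE singletonD)+
    then show ?thesis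
    proof
      assume "signed_product A (x \<otimes> y)"
      then obtain a where a: "power_product a = x \<otimes> y" "\<And>z. \<bar>a z\<bar> \<le> int (count A z)" "\<And>z. even (int (count A z) + a z)"
        by (rule signed_productE) blast
      define t where "t z = (a z + int (count D z)) div 2" for z
      have even: "even (a z + int (count D z))" for z
        using a(3)[of z] evenB[of z] by (simp add: cD)
      have t: "2 * t z = a z + int (count D z)" for z
        using even[of z] by (simp add: t_def)
      have "power_product t \<otimes> power_product t = power_product (\<lambda>z. 2 * t z)"
        using power_product_add[of t t] by (simp only: mult_2)
      also have "\<dots> = power_product (\<lambda>z. a z + int (count D z))" by (simp only: t)
      also have "\<dots> = x \<otimes> x"
        using x c a(1) prodD by (simp add: power_product_add y_def m_assoc flip: mset_product_def)
      finally have "power_product t = x" using square_inj x by blast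
      moreover have "0 \<le> t z" "t z \<le> int (count D z)" for z
        using a(2)[of z] t[of z] cD[of z] by linarith+
      ultimately show ?thesis using uncovered by blast
    next
      assume "signed_product A (inv x \<otimes> y)"
      moreover have "inv x \<otimes> y = g" using x c by (simp add: y_def m_assoc[symmetric])
      ultimately have "signed_product A g" by simp
      then obtain a where a: "power_product a = g" "\<And>z. \<bar>a z\<bar> \<le> int (count A z)" "\<And>z. even (int (count A z) + a z)"
        by (rule signed_productE) blast
      have "power_product (\<lambda>z. a z - \<delta> z) = \<one>" using a(1) power_product_\<delta> c by (simp add: power_product_diff)
      moreover have "\<bar>a z - \<delta> z\<bar> \<le> int (count D z) + \<delta> z" for z
        using a(2)[of z] cD[of z] by (auto simp: \<delta>_def)
      moreover have "even (int (count D z) + \<delta> z + (a z - \<delta> z))" for z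
        using a(3)[of z] evenB[of z] by (simp add: cD)
      ultimately have "(\<lambda>z. a z - \<delta> z) = (\<lambda>z. int (count D z) + \<delta> z) \<or>
          (\<lambda>z. a z - \<delta> z) = (\<lambda>z. - (int (count D z) + \<delta> z))"
        using signed[of "\<lambda>z. a z - \<delta> z"] by blast
      then have "\<bar>a z - \<delta> z\<bar> = int (count D z) + \<delta> z" for z
        by (auto simp: fun_eq_iff \<delta>_def)
      then have "count B z = 0" for z
        using a(2)[of z] cD[of z] by (smt (verit) \<delta>_def of_nat_0_eq_iff of_nat_0_le_iff)
      then show ?thesis by (intro multiset_eqI) simp
    qed
  qed
  \<comment> \<open>Let \<open>a\<close> and \<open>b\<close> be exponents for \<open>x\<close> over \<open>A\<close> and for \<open>y\<close> over \<open>B\<close>. The relation \<open>b - a - \<delta>\<close> is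
    too small at \<open>g\<close> to be \<open>count U\<close>; if it is the negative, then \<open>a\<close> equals \<open>count A\<close>.\<close>
  have different: False if A: "add_mset x A \<in> zero_sums" and B: "add_mset y B \<in> zero_sums" and D: "D = A + B"
    for A B
  proof -
    have cD: "int (count D z) = int (count A z) + int (count B z)" for z by (simp add: D)
    have signed_of: "signed_product S s" if "add_mset s S \<in> zero_sums" for s S
    proof -
      have "s \<in> carrier G" "signed_product S s \<or> signed_product S (inv s)"
        using that by (auto simp: zero_sums_iff signed_product_add_mset)
      then show ?thesis using signed_product_inv by fastforce
    qed
    obtain a where a: "power_product a = x" "\<And>z. \<bar>a z\<bar> \<le> int (count A z)" "\<And>z. even (int (count A z) + a z)"
      using signed_of[OF A] by (rule signed_productE) blast
    obtain b where b: "power_product b = y" "\<And>z. \<bar>b z\<bar> \<le> int (count B z)" "\<And>z. even (int (count B z) + b z)"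
      using signed_of[OF B] by (rule signed_productE) blast
    define w where "w z = b z - a z - \<delta> z" for z
    have "power_product w = (y \<otimes> inv x) \<otimes> inv g"
      using a(1) b(1) power_product_\<delta> unfolding w_def[abs_def] by (simp add: power_product_diff)
    also have "\<dots> = \<one>" using x c by (simp add: y_def m_ac)
    finally have "power_product w = \<one>" .
    moreover have "\<bar>w z\<bar> \<le> int (count D z) + \<delta> z" for z
      using a(2)[of z] b(2)[of z] cD[of z] by (auto simp: \<delta>_def w_def)
    moreover have "even (int (count D z) + \<delta> z + w z)" for z
      using a(3)[of z] b(3)[of z] by (simp add: cD w_def) presburger
    ultimately have "w = (\<lambda>z. int (count D z) + \<delta> z) \<or> w = (\<lambda>z. - (int (count D z) + \<delta> z))"
      using signed[of w] by blast
    then show False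
    proof
      assume "w = (\<lambda>z. int (count D z) + \<delta> z)"
      then have "b g - a g - 1 = int (count D g) + 1" by (simp add: w_def \<delta>_def fun_eq_iff)
      then show False using a(2)[of g] b(2)[of g] cD[of g] by linarith
    next
      assume w: "w = (\<lambda>z. - (int (count D z) + \<delta> z))"
      have "a z - b z = int (count D z)" for z using fun_cong[OF w, of z] by (simp add: w_def)
      then have "0 \<le> a z" "a z \<le> int (count D z)" for z
        using a(2)[of z] b(2)[of z] cD[of z] by smt+
      then show False using uncovered a(1) by blast
    qed
  qed
  show ?thesis
    unfolding atom_def y_def[symmetric]
  proof (intro conjI ballI impI)
    have "signed_product (add_mset y D) (y \<otimes> inv g)"
      using signed_product_plus[OF signed_product_single signed_product_mset_product, of y D] c prodD by simp
    also have "y \<otimes> inv g = x" using x c by (simp add: y_def m_assoc)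
    finally have "signed_product (add_mset x (add_mset y D)) \<one>"
      using x by (simp add: signed_product_add_mset)
    then show "add_mset x (add_mset y D) \<in> zero_sums"
      using x c by (simp add: zero_sums_iff)
    fix A B assume zs: "A \<in> zero_sums" "B \<in> zero_sums" and AB: "add_mset x (add_mset y D) = A + B"
    have *: "A = {#} \<or> B = {#}" if zs: "A \<in> zero_sums" "B \<in> zero_sums"
      and AB: "add_mset x (add_mset y D) = A + B" and xA: "x \<in># A" for A B
    proof -
      obtain A0 where A0: "A = add_mset x A0" using xA by (metis mset_add)
      then have yD: "add_mset y D = A0 + B" using AB by simp
      then have "y \<in># A0 + B" by (metis union_single_eq_member)
      then consider "y \<in># A0" | "y \<in># B" by auto
      then show ?thesis
      proof cases
        case 1
        then obtain A1 where "A0 = add_mset y A1" by (metis mset_add)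
        then show ?thesis using same[of A1 B] zs A0 yD by simp
      next
        case 2
        then obtain B1 where "B = add_mset y B1" by (metis mset_add)
        then show ?thesis using different[of A0 B1] zs A0 yD by simp
      qed
    qed
    have "x \<in># A + B" by (metis AB union_single_eq_member)
    then show "A = {#} \<or> B = {#}"
      using *[OF zs AB] *[OF zs(2,1)] AB by (auto simp: ac_simps)
  qed simp
qed

text \<open>
  By maximality of the size of \<open>U\<close>, the exchange lemma makes every element a power product with exponents between \<open>0\<close> and
  \<open>count (U - {#g#})\<close>. The exponents are unique: the difference of two choices is a bounded relation that is not
  saturated at \<open>g\<close>, hence zero.
\<close>

lemma order_from_tight:
  assumes max: "\<And>A. atom A \<Longrightarrow> size A \<le> size U" and tight: "tight U" and g: "g \<in># U"
  shows "\<forall>x\<in>carrier G. \<exists>t. power_product t = x \<and> (\<forall>z. z \<notin># U \<longrightarrow> t z = 0)"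
    and "order G = (\<Prod>z\<in>set_mset U. count (U - {#g#}) z + 1)"
proof -
  define D where "D = U - {#g#}"
  have U: "U = add_mset g D" using g by (simp add: D_def)
  have covered: "\<exists>t. power_product t = x \<and> (\<forall>z. 0 \<le> t z \<and> t z \<le> int (count D z))" if x: "x \<in> carrier G" for x
  proof (rule ccontr)
    assume "\<not> ?thesis"
    then have "atom (add_mset x (add_mset (x \<otimes> g) D))"
      using exchange_in_tight_is_atom[OF tight[unfolded U] x] by blast
    then show False using max U by fastforce
  qed
  have zero: "t z = 0" if "0 \<le> t z \<and> t z \<le> int (count D z)" "z \<notin># U" for t :: "'a \<Rightarrow> int" and z
  proof -
    have "count D z = 0" using that(2) U by (simp add: count_eq_zero_iff)
    then show ?thesis using that(1) by simp
  qed
  show "\<forall>x\<in>carrier G. \<exists>t. power_product t = x \<and> (\<forall>z. z \<notin># U \<longrightarrow> t z = 0)"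
    using covered zero by blast
  define F where "F = PiE (set_mset U) (\<lambda>z. {0..int (count D z)})"
  define h where "h f = power_product (\<lambda>z. if z \<in># U then f z else 0)" for f
  have "bij_betw h F (carrier G)"
  proof (rule bij_betw_imageI)
    show "inj_on h F"
    proof (rule inj_onI)
      fix f f' assume f: "f \<in> F" "f' \<in> F" "h f = h f'"
      define w where "w z = (if z \<in># U then f z else 0) - (if z \<in># U then f' z else 0)" for z
      have "power_product w = \<one>"
        using f(3) unfolding w_def[abs_def] h_def by (simp add: power_product_diff)
      moreover have bound: "\<bar>w z\<bar> \<le> int (count D z)" for z
      proof (cases "z \<in># U")
        case True
        then have "f z \<in> {0..int (count D z)}" "f' z \<in> {0..int (count D z)}"
          using f(1,2) by (auto simp: F_def)
        then show ?thesis using True by (auto simp: w_def)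
      qed (simp add: w_def)
      moreover have "\<bar>w z\<bar> \<le> int (count U z)" for z
        using bound[of z] by (simp add: U)
      ultimately have "w = (\<lambda>z. 0) \<or> w = (\<lambda>z. int (count U z)) \<or> w = (\<lambda>z. - int (count U z))"
        using tight_bounded_relation[OF tight] by blast
      moreover have "\<bar>w g\<bar> < int (count U g)" using bound[of g] by (simp add: U)
      ultimately have w0: "w = (\<lambda>z. 0)" by auto
      have "f z = f' z" if "z \<in># U" for z using that fun_cong[OF w0, of z] by (simp add: w_def)
      then show "f = f'" using f(1,2) unfolding F_def by (intro PiE_ext) auto
    qed
    show "h ` F = carrier G"
    proof
      show "h ` F \<subseteq> carrier G" by (auto simp: h_def)
      show "carrier G \<subseteq> h ` F"
      proof
        fix x assume "x \<in> carrier G"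
        then obtain t where t: "power_product t = x" "\<And>z. 0 \<le> t z \<and> t z \<le> int (count D z)"
          using covered by blast
        have "t z = 0" if "z \<notin># U" for z using zero[of t z] t(2) that by blast
        then have "(\<lambda>z. if z \<in># U then restrict t (set_mset U) z else 0) = t"
          by auto
        then have "h (restrict t (set_mset U)) = x" using t(1) by (simp add: h_def)
        moreover have "restrict t (set_mset U) \<in> F" using t(2) by (auto simp: F_def)
        ultimately show "x \<in> h ` F" by blast
      qed
    qed
  qed
  then have "order G = card F" by (simp add: order_def bij_betw_same_card)
  also have "\<dots> = (\<Prod>z\<in>set_mset U. card {0..int (count D z)})"
    unfolding F_def by (rule card_PiE) simp
  also have "\<dots> = (\<Prod>z\<in>set_mset U. count D z + 1)"
    by (intro prod.cong) (auto simp: nat_add_distrib)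
  finally show "order G = (\<Prod>z\<in>set_mset U. count (U - {#g#}) z + 1)" by (simp add: D_def)
qed

text \<open>
  A parity argument: all factors of the odd number \<open>order G\<close> in its product formula are odd. With \<open>z = g\<close> this says that each
  multiplicity in \<open>U\<close> is odd, and with \<open>z \<noteq> g\<close> that the multiplicity of \<open>z\<close> is even.
\<close>

lemma cyclic_if_tight:
  assumes max: "\<And>A. atom A \<Longrightarrow> size A \<le> size U" and tight: "tight U" and ne: "U \<noteq> {#}"
  shows "cyclic_group G" "order G = size U"
proof -
  have odd: "odd (count (U - {#g#}) z + 1)" if "g \<in># U" "z \<in># U" for g z
    using odd_order order_from_tight(2)[OF max tight that(1)] that(2)
      dvd_prod_eqI[of "set_mset U" z _ "\<lambda>z. count (U - {#g#}) z + 1"]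
    by (metis (no_types, lifting) dvd_prodI dvd_trans finite_set_mset)
  have odd_count: "odd (count U g)" if "g \<in># U" for g
    using odd[OF that that] that by (metis Suc_eq_plus1 count_diff diff_add_inverse2 insert_DiffM count_add_mset)
  obtain g where g: "g \<in># U" using ne by blast
  have all: "z = g" if z: "z \<in># U" for z
  proof (rule ccontr)
    assume "z \<noteq> g"
    then have "odd (count U z + 1)" using odd[OF g z] by simp
    then show False using odd_count[OF z] by simp
  qed
  then have single: "set_mset U = {g}" using g all by blast
  then have "order G = count (U - {#g#}) g + 1"
    using order_from_tight(2)[OF max tight g] by simp
  also have "\<dots> = count U g" using count_greater_zero_iff[of U g] g by simp
  also have "\<dots> = size U" using single by (simp add: size_multiset_overloaded_eq)
  finally show "order G = size U" .
  have gc: "g \<in> carrier G" using tight g by (auto simp: tight_def)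
  have "carrier G \<subseteq> range (\<lambda>k::int. g [^] k)"
  proof
    fix x assume "x \<in> carrier G"
    then obtain t where t: "power_product t = x" "\<And>z. z \<notin># U \<Longrightarrow> t z = 0"
      using order_from_tight(1)[OF max tight g] by blast
    then have "t = (\<lambda>z. if z = g then t g else 0)" using single by auto
    then have "x = g [^] t g" using t(1) power_product_single[OF gc, of "t g"] by simp
    then show "x \<in> range (\<lambda>k::int. g [^] k)" by blast
  qed
  then have "carrier G = range (\<lambda>k::int. g [^] k)" using gc by auto
  then show "cyclic_group G" using cyclic_group gc by blast
qed

end

section \<open>Cyclic groups\<close>

lemma (in group) cyclic_group_obtain_generator:
  assumes "cyclic_group G"
  obtains g where "g \<in> carrier G" "ord g = order G" "carrier G = range (\<lambda>k::int. g [^] k)"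
proof -
  obtain g where g: "g \<in> carrier G" "subgroup_generated G {g} = G"
    using assms unfolding cyclic_group_def by blast
  then have gen: "generate G {g} = carrier G"
    by (metis carrier_subgroup_generated Int_insert_right_if1 Int_empty_right)
  then have "ord g = order G" using generate_pow_card[OF g(1)] by (simp add: order_def)
  moreover have "carrier G = range (\<lambda>k::int. g [^] k)"
    unfolding gen[symmetric] generate_pow[OF g(1)] by auto
  ultimately show ?thesis using that g(1) by blast
qed

lemma cyclic_groups_of_same_order_iso:
  assumes "group G" "group H" "cyclic_group G" "cyclic_group H" "order G = order H"
  shows "G \<cong> H"
proof -
  interpret G: group G by fact
  interpret H: group H by fact
  obtain g where g: "g \<in> carrier G" "G.ord g = order G" "carrier G = range (\<lambda>k::int. g [^]\<^bsub>G\<^esub> k)"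
    by (rule G.cyclic_group_obtain_generator[OF assms(3)])
  obtain h where h: "h \<in> carrier H" "H.ord h = order H" "carrier H = range (\<lambda>k::int. h [^]\<^bsub>H\<^esub> k)"
    by (rule H.cyclic_group_obtain_generator[OF assms(4)])
  have eq: "g [^]\<^bsub>G\<^esub> k = g [^]\<^bsub>G\<^esub> l \<longleftrightarrow> h [^]\<^bsub>H\<^esub> k = h [^]\<^bsub>H\<^esub> l" for k l :: int
    using G.int_pow_eq[OF g(1)] H.int_pow_eq[OF h(1)] g(2) h(2) assms(5) by simp
  define f where "f x = h [^]\<^bsub>H\<^esub> (SOME k::int. x = g [^]\<^bsub>G\<^esub> k)" for x
  have f: "f (g [^]\<^bsub>G\<^esub> k) = h [^]\<^bsub>H\<^esub> k" for k :: int
  proof -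
    have "g [^]\<^bsub>G\<^esub> k = g [^]\<^bsub>G\<^esub> (SOME l::int. g [^]\<^bsub>G\<^esub> k = g [^]\<^bsub>G\<^esub> l)"
      by (rule someI) (rule refl)
    then show ?thesis using eq unfolding f_def by metis
  qed
  have "f \<in> iso G H"
  proof (rule isoI)
    show "f \<in> hom G H"
    proof (rule homI)
      fix x assume "x \<in> carrier G"
      then show "f x \<in> carrier H" using f g(3) h(1) by auto
      fix y assume "y \<in> carrier G"
      with \<open>x \<in> carrier G\<close> obtain k l :: int where "x = g [^]\<^bsub>G\<^esub> k" "y = g [^]\<^bsub>G\<^esub> l"
        using g(3) by auto
      then show "f (x \<otimes>\<^bsub>G\<^esub> y) = f x \<otimes>\<^bsub>H\<^esub> f y"
        using f g(1) h(1) by (simp flip: G.int_pow_mult H.int_pow_mult)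
    qed
    show "bij_betw f (carrier G) (carrier H)"
    proof (rule bij_betw_imageI)
      show "inj_on f (carrier G)" using f eq unfolding g(3) by (auto simp: inj_on_def)
      show "f ` carrier G = carrier H" using f unfolding g(3) h(3) by (auto simp: image_image)
    qed
  qed
  then show ?thesis by (rule is_isoI)
qed

context odd_abelian_group
begin

text \<open>
  The sum of \<open>k\<close> signs has the parity of \<open>k\<close> and absolute value at most \<open>k\<close>, and it must be a multiple of the odd number
  \<open>order G\<close>.
\<close>

lemma replicate_in_zero_sums_iff:
  assumes g: "g \<in> carrier G" "ord g = order G"
  shows "replicate_mset k g \<in> zero_sums \<longleftrightarrow> even k \<or> order G \<le> k"
proof
  assume "replicate_mset k g \<in> zero_sums"
  then have "signed_product (replicate_mset k g) \<one>" by (simp add: zero_sums_iff)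
  then obtain w where w: "power_product w = \<one>" "\<And>x. \<bar>w x\<bar> \<le> int (count (replicate_mset k g) x)"
    "\<And>x. even (int (count (replicate_mset k g) x) + w x)"
    by (rule signed_productE) blast
  have wg: "\<bar>w g\<bar> \<le> int k" "even (int k + w g)" using w(2,3)[of g] by auto
  have "w x = 0" if "x \<noteq> g" for x using w(2)[of x] that by simp
  then have "w = (\<lambda>x. if x = g then w g else 0)" by auto
  then have "g [^] w g = \<one>" using w(1) power_product_single[OF g(1), of "w g"] by simp
  then have dvd: "int (order G) dvd w g" using int_pow_eq_id[OF g(1)] g(2) by simp
  show "even k \<or> order G \<le> k"
  proof (cases "w g = 0")
    case True
    then show ?thesis using wg by simp
  next
    case False
    then have "int (order G) \<le> \<bar>w g\<bar>" using dvd_imp_le_int[OF False dvd] by simp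
    then have "int (order G) \<le> int k" using wg(1) by linarith
    then show ?thesis by simp
  qed
next
  assume k: "even k \<or> order G \<le> k"
  show "replicate_mset k g \<in> zero_sums"
  proof (cases "even k")
    case True
    then obtain j where "k = j + j" by (metis evenE mult_2)
    moreover have "replicate_mset (j + j) g = replicate_mset j g + replicate_mset j g"
      by (rule multiset_eqI) simp
    ultimately show ?thesis using zero_sums_double[of "replicate_mset j g"] g(1)
      by (auto split: if_splits)
  next
    case False
    have "power_product (\<lambda>x. if x = g then int (order G) else 0) = \<one>"
      using g(1) by (simp add: power_product_single int_pow_int pow_order_eq_1)
    then have "signed_product (replicate_mset k g) \<one>"
      by (rule signed_productI) (use k False odd_order in auto)
    then show ?thesis using g(1) by (auto simp: zero_sums_iff split: if_splits)
  qed
qed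

lemma atom_replicate_iff:
  assumes g: "g \<in> carrier G" "ord g = order G" and n: "3 \<le> order G"
  shows "atom (replicate_mset k g) \<longleftrightarrow> k = 2 \<or> k = order G"
proof
  note zs = replicate_in_zero_sums_iff[OF g]
  have split: "replicate_mset (i + j) g = replicate_mset i g + replicate_mset j g" for i j
    by (rule multiset_eqI) simp
  have split_atom: "i = 0 \<or> j = 0" if "atom (replicate_mset (i + j) g)"
    "even i \<or> order G \<le> i" "even j \<or> order G \<le> j" for i j
    using atomD[of "replicate_mset i g" "replicate_mset j g"] that zs unfolding split by auto
  {
    assume atom: "atom (replicate_mset k g)"
    then have k: "k \<noteq> 0" "even k \<or> order G \<le> k"
      using atom_nonempty atom_zero_sum zs by fastforce+
    show "k = 2 \<or> k = order G"
    proof (cases "even k")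
      case True
      then have "2 \<le> k" using k(1) by (auto elim!: evenE)
      then have "atom (replicate_mset (2 + (k - 2)) g)" using atom by (simp only: le_add_diff_inverse)
      then have "(2::nat) = 0 \<or> k - 2 = 0" by (rule split_atom) (use True in auto)
      then show ?thesis using \<open>2 \<le> k\<close> by simp
    next
      case False
      then show ?thesis using split_atom[of "order G" "k - order G"] atom k odd_order n by auto
    qed
  next
    assume k: "k = 2 \<or> k = order G"
    show "atom (replicate_mset k g)"
      unfolding atom_def
    proof (intro conjI ballI impI)
      show "replicate_mset k g \<in> zero_sums" using zs[of k] k by auto
      show "replicate_mset k g \<noteq> {#}" using k n by auto
      fix A B assume AB: "A \<in> zero_sums" "B \<in> zero_sums" "replicate_mset k g = A + B"
      have "set_mset (A + B) \<subseteq> {g}" using AB(3) by (metis set_mset_replicate_mset_subset empty_subsetI order_refl)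
      then have A: "A = replicate_mset (size A) g" and B: "B = replicate_mset (size B) g"
        by (auto intro: set_mset_subset_singletonD)
      have "even (size A) \<or> order G \<le> size A" "even (size B) \<or> order G \<le> size B"
        using zs[of "size A"] zs[of "size B"] AB(1,2) by (simp_all only: A[symmetric] B[symmetric])
      moreover have sum: "k = size A + size B" using arg_cong[OF AB(3), of size] by simp
      ultimately have "size A = 0 \<or> size B = 0"
      proof (cases "even (size A) \<and> even (size B)")
        case True
        then have "even k" using sum by simp
        then have "k = 2" using k odd_order by auto
        moreover obtain i j where ij: "size A = 2 * i" "size B = 2 * j"
          using True by (meson evenE)
        ultimately have "2 * i + 2 * j = 2" using sum by simp
        then have "i = 0 \<or> j = 0" by presburger
        then show ?thesis using ij by auto
      next
        case False
        then have "order G \<le> size A \<or> order G \<le> size B"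
          using \<open>even (size A) \<or> _\<close> \<open>even (size B) \<or> _\<close> by blast
        then show ?thesis using k n sum by linarith
      qed
      then show "A = {#} \<or> B = {#}" by simp
    qed
  }
qed

text \<open>
  A factorization with \<open>a\<close> factors of size \<open>2\<close> and \<open>b\<close> of size \<open>order G\<close> satisfies
  \<open>2 * order G = 2 * a + order G * b\<close>. As \<open>order G\<close> is odd, \<open>b\<close> is \<open>0\<close> or \<open>2\<close>.
\<close>

lemma set_of_lengths_generator_power:
  assumes g: "g \<in> carrier G" "ord g = order G" and n: "3 \<le> order G"
  shows "set_of_lengths (pm_monoid G) (replicate_mset (2 * order G) g) = {2, order G}"
proof (intro equalityI subsetI)
  fix k assume "k \<in> set_of_lengths (pm_monoid G) (replicate_mset (2 * order G) g)"
  then obtain fs where fs: "k = length fs" "\<And>A. A \<in> set fs \<Longrightarrow> atom A" "sum_list fs = replicate_mset (2 * order G) g"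
    by (auto simp: set_of_lengths_eq)
  have "size A \<in> {2, order G}" if A: "A \<in> set fs" for A
  proof -
    have "set_mset A \<subseteq> {g}"
      using set_mset_mono[OF member_sum_list_subset[OF A]] fs(3) by (auto split: if_splits)
    then have "A = replicate_mset (size A) g" by (rule set_mset_subset_singletonD)
    then show ?thesis using fs(2)[OF A] atom_replicate_iff[OF g n, of "size A"] by auto
  qed
  then obtain a b where ab: "k = a + b" "2 * order G = 2 * a + order G * b"
    using sum_list_of_two_values[of "map size fs" 2 "order G"] fs size_sum_list[of fs] by auto
  have "even (order G * b)" using ab(2) by (metis dvd_add_right_iff dvd_triv_left)
  then have "even b" using odd_order by simp
  have "order G * b \<le> order G * 2" using ab(2) by linarith
  then have "b \<le> 2" using n by simp
  then consider "b = 0" | "b = 2" using \<open>even b\<close> by (cases "b = 1") (auto simp: le_Suc_eq numeral_2_eq_2)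
  then show "k \<in> {2, order G}" using ab by cases auto
next
  fix k assume k: "k \<in> {2, order G}"
  have two: "sum_list (replicate m (replicate_mset j g)) = replicate_mset (m * j) g" for m j
    by (induction m) (auto intro!: multiset_eqI)
  have "\<exists>fs. length fs = k \<and> (\<forall>A\<in>set fs. atom A) \<and> sum_list fs = replicate_mset (2 * order G) g"
  proof (cases "k = 2")
    case True
    then show ?thesis using two[of 2 "order G"] atom_replicate_iff[OF g n]
      by (intro exI[of _ "replicate 2 (replicate_mset (order G) g)"]) auto
  next
    case False
    then show ?thesis using k two[of "order G" 2] atom_replicate_iff[OF g n]
      by (intro exI[of _ "replicate (order G) (replicate_mset 2 g)"]) (auto simp: mult.commute)
  qed
  then show "k \<in> set_of_lengths (pm_monoid G) (replicate_mset (2 * order G) g)"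
    by (auto simp: set_of_lengths_eq)
qed

end

section \<open>The characterization\<close>

theorem theorem6p10:
  fixes G :: "'a monoid" and G' :: "'b monoid"
  assumes "group G" and "finite (carrier G)" and "cyclic_group G"
    and "odd (order G)" and "order G \<ge> 3"
    and "comm_group G'" and "finite (carrier G')" and "odd (order G')"
    and "system_of_lengths (pm_monoid G') = system_of_lengths (pm_monoid G)"
  shows "G \<cong> G'"
proof -
  interpret G: odd_abelian_group G
    using assms(1-4) group.cyclic_imp_abelian_group
    by (auto simp: odd_abelian_group_def finite_abelian_group_def
        finite_abelian_group_axioms_def odd_abelian_group_axioms_def)
  interpret G': odd_abelian_group G'
    using assms(6-8)
    by (auto simp: odd_abelian_group_def finite_abelian_group_def
        finite_abelian_group_axioms_def odd_abelian_group_axioms_def)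
  note same = assms(9)[unfolded system_of_lengths_def]
  have max: "size U \<le> order G" if U: "G'.atom U" for U
  proof (cases "\<one>\<^bsub>G'\<^esub> \<in># U \<or> size U \<le> 2")
    case True
    then show ?thesis using G'.atom_containing_one[OF U] assms(5) by auto
  next
    case False
    have "U + U \<in> carrier (pm_monoid G')"
      using U G'.atom_zero_sum G'.zero_sums_plus by blast
    then obtain V where
      V: "set_of_lengths (pm_monoid G') (U + U) = set_of_lengths (pm_monoid G) V"
      using same by blast
    have "2 \<in> set_of_lengths (pm_monoid G) V" "size U \<in> set_of_lengths (pm_monoid G) V"
      using G'.lengths_of_atom_square[OF U] False V by auto
    then show ?thesis
      using G.length_le_max_atom_size(1)[OF G.atom_size_le_order] False by simp
  qed
  obtain g where g: "g \<in> carrier G" "G.ord g = order G"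
    using G.cyclic_group_obtain_generator[OF assms(3)] by blast
  have "replicate_mset (2 * order G) g \<in> carrier (pm_monoid G)"
    using G.replicate_in_zero_sums_iff[OF g] by simp
  then obtain V where V: "V \<in> carrier (pm_monoid G')"
    "set_of_lengths (pm_monoid G') V = {2, order G}"
    using same G.set_of_lengths_generator_power[OF g assms(5)] by (metis (no_types, lifting) image_iff)
  obtain U where U: "G'.tight U" "size U = order G"
    using G'.exists_tight[OF max V assms(5)] by blast
  then have "U \<noteq> {#}" using assms(5) by auto
  then have "cyclic_group G'" "order G' = order G"
    using G'.cyclic_if_tight[of U] max U by auto
  then show ?thesis
    using cyclic_groups_of_same_order_iso[OF assms(1) G'.is_group assms(3)] by simp
qed

end
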